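(* Let $I$ be a finitely generated graded $T$-ideal, $k/F$ a field extension, and $B=(V_k,\mu)$ a $k$-point of $\mathrm{Alg}^G_{\mathbf d}(I)$. If $B$ is a smooth point of $\mathrm{Alg}^G_{\mathbf d}(I)$, then every $I$-preserving first-order deformation of $B$ lifts to a compatible unital graded $I$-preserving multiplication over $k[t]/(t^{N+1})$ for every $N\ge2$. In particular, $\mathrm{ob}^{(2)}_{I,B}(\varphi)=0$ for every $\varphi\in Z^2_{G,I,\mathrm n}(B,B)$.
   Context: $F$ is a field of characteristic zero and $G$ is a finite group with neutral element $e$. Algebras are associative and unital. $F\langle X\mid G\rangle$ is the free associative algebra on variables $x_i^g$ of degree $g\in G$; a graded $T$-ideal is an ideal of it stable under all graded endomorphisms; a $G$-graded algebra satisfies $I$ if every degree-preserving evaluation of every $f\in I$ vanishes. For a dimension vector $\mathbf d=(d_g)$ with $d_e\ge1$, fix graded $F$-vector spaces $V=\bigoplus V_g$, $\dim_FV_g=d_g$, with a nonzero vector $\mathbf1\in V_e$; $V_k=V\otimes_Fk$. $\mathrm{Alg}^G_{\mathbf d}(I)$ is the closed subscheme of $\bigoplus_{g,h}\operatorname{Hom}_F(V_g\otimes V_h,V_{gh})$ defined by associativity, $\mathbf1$ being a two-sided unit, and the vanishing of all evaluations on homogeneous basis vectors of finitely many multilinear generators of $I$. $C^n_{G,\mathrm n}(B,B)$ is the space of degree-preserving $k$-multilinear maps $B^{\otimes n}\to B$ vanishing when some argument is $1$; for 2-cochains, $\partial_\mu\psi(x,y,z)=d_{\mathrm{Hoch}}\psi(x,y,z)=\psi(xy,z)-\psi(x,yz)+\psi(x,y)z-x\psi(y,z)$.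 Fix finitely many multilinear graded $T$-generators $f_1,\dots,f_r$ of $I$ ($f_j$ in $m_j$ variables) with fixed bracketings, so evaluation of $f_j$ is a polynomial function of the multiplication law; $D_\mu f_j$ and $D^2_\mu f_j$ are its first and second differentials at $\mu$. $Z^2_{G,I,\mathrm n}(B,B)$ is the set of $\varphi\in C^2_{G,\mathrm n}(B,B)$ with $d_{\mathrm{Hoch}}\varphi=0$ and $D_\mu f(\varphi)=0$ for all $f\in I$; equivalently, $\mu+t\varphi$ is an $I$-preserving (associative, unital, graded, satisfying $I$) first-order deformation over $k[t]/(t^2)$. Put $Q_{\mathrm{ass}}(\varphi)(x,y,z)=\varphi(\varphi(x,y),z)-\varphi(x,\varphi(y,z))$, $Q_j(\varphi)=\frac12D_\mu^2f_j(\varphi,\varphi)$, $\mathcal L_{I,B}(\psi)=(\partial_\mu\psi,D_\mu f_1(\psi),\dots,D_\mu f_r(\psi))\in C^3_{G,\mathrm n}(B,B)\oplus\bigoplus_j\operatorname{Hom}_k(B^{\otimes m_j},B)$ for $\psi\in C^2_{G,\mathrm n}(B,B)$, and $\mathrm{ob}^{(2)}_{I,B}(\varphi)=[Q_{\mathrm{ass}}(\varphi),Q_1(\varphi),\dots,Q_r(\varphi)]\in\operatorname{coker}\mathcal L_{I,B}$. *)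

theory Defs
  imports
    "HOL-Library.Poly_Mapping"
    "HOL-Library.Multiset"
    "HOL-Library.Function_Algebras"
    "HOL-Library.Product_Plus"
    "HOL-Computational_Algebra.Polynomial"
begin

definition unital_ring_hom :: "('a::ring_1 \<Rightarrow> 'b::ring_1) \<Rightarrow> bool" where
  "unital_ring_hom h \<longleftrightarrow>
     h 1 = 1 \<and> (\<forall>x y. h (x + y) = h x + h y) \<and> (\<forall>x y. h (x * y) = h x * h y)"


section \<open>The free graded algebra and graded T-ideals\<close>

text \<open>
  The group \<open>G\<close> is a type of class \<^class>\<open>group_add\<close>: it is written additively, with
  neutral element \<open>0\<close>, but is not assumed to be commutative.  The free algebra is the monoid
  algebra of the free monoid of words; the variable \<open>x\<^sub>i\<^sup>g\<close> is the pair \<open>(i, g)\<close>.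
\<close>

datatype 'x word = Word (letters: "'x list")

instantiation word :: (type) monoid_add
begin

definition zero_word :: "'x word" where "zero_word = Word []"

definition plus_word :: "'x word \<Rightarrow> 'x word \<Rightarrow> 'x word" where
  "plus_word v w = Word (letters v @ letters w)"

instance
  by standard (simp_all add: zero_word_def plus_word_def)

end

type_synonym 'g gvar = "nat \<times> 'g"
type_synonym ('f, 'g) free_alg = "'g gvar word \<Rightarrow>\<^sub>0 'f"

definition free_const :: "'f::field \<Rightarrow> ('f, 'g) free_alg" where
  "free_const c = Poly_Mapping.single 0 c"

definition word_degree :: "'g::group_add gvar word \<Rightarrow> 'g" where
  "word_degree w = sum_list (map snd (letters w))"

definition free_component :: "'g::group_add \<Rightarrow> ('f::field, 'g) free_alg set" where
  "free_component g = {p. \<forall>w\<in>Poly_Mapping.keys p. word_degree w = g}"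

definition graded_endomorphism ::
  "(('f::field, 'g::group_add) free_alg \<Rightarrow> ('f, 'g) free_alg) \<Rightarrow> bool" where
  "graded_endomorphism \<sigma> \<longleftrightarrow>
     unital_ring_hom \<sigma> \<and> (\<forall>c. \<sigma> (free_const c) = free_const c) \<and>
     (\<forall>g. \<sigma> ` free_component g \<subseteq> free_component g)"

definition graded_T_ideal :: "('f::field, 'g::group_add) free_alg set \<Rightarrow> bool" where
  "graded_T_ideal J \<longleftrightarrow>
     0 \<in> J \<and> (\<forall>p\<in>J. \<forall>q\<in>J. p + q \<in> J) \<and> (\<forall>p\<in>J. \<forall>a. a * p \<in> J \<and> p * a \<in> J) \<and>
     (\<forall>\<sigma>. graded_endomorphism \<sigma> \<longrightarrow> \<sigma> ` J \<subseteq> J)"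

definition T_ideal_generated ::
  "('f::field, 'g::group_add) free_alg set \<Rightarrow> ('f, 'g) free_alg set" where
  "T_ideal_generated S = \<Inter>{J. graded_T_ideal J \<and> S \<subseteq> J}"


section \<open>Multilinear generators with fixed bracketings\<close>

datatype 'x bracketing = Leaf 'x | Node "'x bracketing" "'x bracketing"

primrec leaves :: "'x bracketing \<Rightarrow> 'x list" where
  "leaves (Leaf v) = [v]"
| "leaves (Node s t) = leaves s @ leaves t"

fun right_normed :: "'x list \<Rightarrow> 'x bracketing" where
  "right_normed [v] = Leaf v"
| "right_normed (v # w # ws) = Node (Leaf v) (right_normed (w # ws))"

text \<open>
  A generator \<open>f(x\<^sub>1, \<dots>, x\<^sub>m)\<close> together with the list of its \<open>m\<close> variables and a
  bracketing of every monomial.  The empty monomial, which occurs only for \<open>m = 0\<close>, has no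
  bracketing and evaluates to the unit.
\<close>

record (overloaded) ('f, 'g) mgen =
  gen_poly :: "('f, 'g) free_alg"
  gen_vars :: "'g gvar list"
  gen_br :: "'g gvar word \<Rightarrow> 'g gvar bracketing"

definition multilinear_generator :: "('f::field, 'g::group_add) mgen \<Rightarrow> bool" where
  "multilinear_generator f \<longleftrightarrow>
     distinct (gen_vars f) \<and>
     (\<forall>w\<in>Poly_Mapping.keys (gen_poly f).
        mset (letters w) = mset (gen_vars f) \<and>
        (letters w \<noteq> [] \<longrightarrow> leaves (gen_br f w) = letters w))"


section \<open>Multiplication laws and evaluations\<close>

text \<open>
  The graded space \<open>V\<close> has a homogeneous basis indexed by the finite type \<open>'b\<close>, with
  degrees \<open>deg :: 'b \<Rightarrow> 'g\<close>, so that \<open>d\<^sub>g\<close> is the number of \<open>b\<close> with \<open>deg b = g\<close>.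
  For a commutative ring \<open>R\<close>, elements of \<open>V \<otimes> R\<close> are coordinate functions
  \<open>'b \<Rightarrow> 'r\<close>, and a bilinear map is given by its structure constants: \<open>c i j l\<close> is the
  coefficient of \<open>e\<^sub>l\<close> in \<open>e\<^sub>i e\<^sub>j\<close>.  Throughout, \<open>\<iota>\<close> is the structure map
  \<open>F \<rightarrow> R\<close>, and \<open>u\<close> is the vector \<open>\<one> \<in> V\<close>.
\<close>

type_synonym ('b, 'r) law = "'b \<Rightarrow> 'b \<Rightarrow> 'b \<Rightarrow> 'r"

definition basis_vec :: "'b \<Rightarrow> 'b \<Rightarrow> 'r::comm_ring_1" where
  "basis_vec b = (\<lambda>l. if l = b then 1 else 0)"

definition homogeneous :: "('b \<Rightarrow> 'g) \<Rightarrow> 'g \<Rightarrow> ('b \<Rightarrow> 'r::comm_ring_1) \<Rightarrow> bool" where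
  "homogeneous deg g x \<longleftrightarrow> (\<forall>b. x b \<noteq> 0 \<longrightarrow> deg b = g)"

definition component :: "('b \<Rightarrow> 'g) \<Rightarrow> 'g \<Rightarrow> ('b \<Rightarrow> 'r::comm_ring_1) \<Rightarrow> 'b \<Rightarrow> 'r" where
  "component deg g x = (\<lambda>b. if deg b = g then x b else 0)"

definition mult :: "('b::finite, 'r::comm_ring_1) law \<Rightarrow> ('b \<Rightarrow> 'r) \<Rightarrow> ('b \<Rightarrow> 'r) \<Rightarrow> 'b \<Rightarrow> 'r" where
  "mult c x y = (\<lambda>l. \<Sum>i\<in>UNIV. \<Sum>j\<in>UNIV. x i * y j * c i j l)"

primrec bracket_eval ::
  "('b::finite, 'r::comm_ring_1) law \<Rightarrow> ('x \<Rightarrow> 'b \<Rightarrow> 'r) \<Rightarrow> 'x bracketing \<Rightarrow> 'b \<Rightarrow> 'r" where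
  "bracket_eval c \<rho> (Leaf v) = \<rho> v"
| "bracket_eval c \<rho> (Node s t) = mult c (bracket_eval c \<rho> s) (bracket_eval c \<rho> t)"

definition free_eval ::
  "('f::field \<Rightarrow> 'r::comm_ring_1) \<Rightarrow> ('b::finite \<Rightarrow> 'f) \<Rightarrow> ('b, 'r) law \<Rightarrow>
   ('g gvar word \<Rightarrow> 'g gvar bracketing) \<Rightarrow> ('g gvar \<Rightarrow> 'b \<Rightarrow> 'r) \<Rightarrow>
   ('f, 'g) free_alg \<Rightarrow> 'b \<Rightarrow> 'r" where
  "free_eval \<iota> u c br \<rho> f = (\<lambda>l. \<Sum>w\<in>Poly_Mapping.keys f. \<iota> (Poly_Mapping.lookup f w) *
     (if letters w = [] then \<iota> (u l) else bracket_eval c \<rho> (br w) l))"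

text \<open>
  For elements of the free algebra without a chosen bracketing, monomials are bracketed to the
  right; this is used only for laws, and first-order variations of laws, that are associative,
  where the choice is immaterial.
\<close>

abbreviation std_br :: "'x word \<Rightarrow> 'x bracketing" where
  "std_br \<equiv> (\<lambda>w. right_normed (letters w))"

text \<open>
  \<open>graded_I_law \<iota> m deg u I c\<close>: the structure constants \<open>c\<close>, taken modulo \<open>m\<close>, are a
  graded associative multiplication on \<open>V \<otimes> R/(m)\<close> with unit \<open>\<one>\<close> that satisfies \<open>I\<close>.
\<close>

definition graded_I_law ::
  "('f::field \<Rightarrow> 'r::comm_ring_1) \<Rightarrow> 'r \<Rightarrow> ('b::finite \<Rightarrow> 'g::group_add) \<Rightarrow> ('b \<Rightarrow> 'f) \<Rightarrow>
   ('f, 'g) free_alg set \<Rightarrow> ('b, 'r) law \<Rightarrow> bool" where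
  "graded_I_law \<iota> m deg u I c \<longleftrightarrow>
     (\<forall>i j l. deg l \<noteq> deg i + deg j \<longrightarrow> m dvd c i j l) \<and>
     (\<forall>x y z l. m dvd (mult c (mult c x y) z l - mult c x (mult c y z) l)) \<and>
     (\<forall>x l. m dvd (mult c (\<lambda>b. \<iota> (u b)) x l - x l) \<and>
            m dvd (mult c x (\<lambda>b. \<iota> (u b)) l - x l)) \<and>
     (\<forall>f\<in>I. \<forall>\<rho>. (\<forall>v. homogeneous deg (snd v) (\<rho> v)) \<longrightarrow>
        (\<forall>l. m dvd free_eval \<iota> u c std_br \<rho> f l))"

text \<open>
  The evaluation of a generator is a function of \<open>m\<close> arguments in \<open>V \<otimes> R\<close>: the variable
  \<open>x\<^sub>i\<^sup>g\<close> takes the degree \<open>g\<close> component of its argument, so the multilinear map on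
  \<open>V\<^bsub>g1\<^esub> \<otimes> \<dots> \<otimes> V\<^bsub>gm\<^esub>\<close> is extended by zero to the other components of
  \<open>V\<^sup>\<otimes>\<^sup>m\<close>.
\<close>

definition assign ::
  "('b \<Rightarrow> 'g) \<Rightarrow> 'g gvar list \<Rightarrow> ('b \<Rightarrow> 'r::comm_ring_1) list \<Rightarrow> 'g gvar \<Rightarrow> 'b \<Rightarrow> 'r" where
  "assign deg vs xs v =
     (case map_of (zip vs xs) v of Some x \<Rightarrow> component deg (snd v) x | None \<Rightarrow> (\<lambda>_. 0))"


section \<open>Polynomials, ideals and smooth points of affine schemes\<close>

type_synonym ('v, 'f) mpoly = "('v \<Rightarrow>\<^sub>0 nat) \<Rightarrow>\<^sub>0 'f"

definition pconst :: "'f::comm_ring_1 \<Rightarrow> ('v, 'f) mpoly" where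
  "pconst c = Poly_Mapping.single 0 c"

definition pvar :: "'v \<Rightarrow> ('v, 'f::comm_ring_1) mpoly" where
  "pvar v = Poly_Mapping.single (Poly_Mapping.single v 1) 1"

definition peval ::
  "('f::comm_ring_1 \<Rightarrow> 'r::comm_ring_1) \<Rightarrow> ('v \<Rightarrow> 'r) \<Rightarrow> ('v, 'f) mpoly \<Rightarrow> 'r" where
  "peval \<iota> x p = (\<Sum>m\<in>Poly_Mapping.keys p. \<iota> (Poly_Mapping.lookup p m) *
     (\<Prod>v\<in>Poly_Mapping.keys m. x v ^ Poly_Mapping.lookup m v))"

abbreviation psubst ::
  "('v \<Rightarrow> ('w, 'f::comm_ring_1) mpoly) \<Rightarrow> ('v, 'f) mpoly \<Rightarrow> ('w, 'f) mpoly" where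
  "psubst \<equiv> peval pconst"

definition polys_in :: "'v set \<Rightarrow> ('v, 'f::comm_ring_1) mpoly set" where
  "polys_in A = {p. \<forall>m\<in>Poly_Mapping.keys p. Poly_Mapping.keys m \<subseteq> A}"

definition ideal :: "'a::comm_ring_1 set \<Rightarrow> 'a set" where
  "ideal S = module.span (*) S"

text \<open>The derivative of \<open>t \<mapsto> p(q + t e\<^sub>v)\<close> at \<open>t = 0\<close>.\<close>

definition partial_deriv ::
  "('f::field \<Rightarrow> 'k::field) \<Rightarrow> ('v \<Rightarrow> 'k) \<Rightarrow> 'v \<Rightarrow> ('v, 'f) mpoly \<Rightarrow> 'k" where
  "partial_deriv \<iota> q v p =
     poly (pderiv (peval (\<lambda>c. [:\<iota> c:]) (\<lambda>w. if w = v then [:q w, 1:] else [:q w:]) p)) 0"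

text \<open>
  Substitution along \<open>a\<close> and \<open>b\<close> induces mutually inverse isomorphisms of \<open>F\<close>-algebras
  \<open>F[A]/(S) \<cong> F[B]/(T)\<close>.  It makes no difference that \<^const>\<open>ideal\<close> takes the ideals in
  the polynomial ring in all variables: they contract to the ideals generated by \<open>S\<close> and
  \<open>T\<close> in \<open>F[A]\<close> and \<open>F[B]\<close>.
\<close>

definition presentation_iso ::
  "'v set \<Rightarrow> ('v, 'f::field) mpoly set \<Rightarrow> 'w set \<Rightarrow> ('w, 'f) mpoly set \<Rightarrow>
   ('v \<Rightarrow> ('w, 'f) mpoly) \<Rightarrow> ('w \<Rightarrow> ('v, 'f) mpoly) \<Rightarrow> bool" where
  "presentation_iso A S B T a b \<longleftrightarrow>
     S \<subseteq> polys_in A \<and> T \<subseteq> polys_in B \<and>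
     (\<forall>v\<in>A. a v \<in> polys_in B) \<and> (\<forall>w\<in>B. b w \<in> polys_in A) \<and>
     (\<forall>p\<in>S. psubst a p \<in> ideal T) \<and> (\<forall>p\<in>T. psubst b p \<in> ideal S) \<and>
     (\<forall>v\<in>A. psubst b (a v) - pvar v \<in> ideal S) \<and>
     (\<forall>w\<in>B. psubst a (b w) - pvar w \<in> ideal T)"

text \<open>
  Smoothness over \<open>F\<close> of \<open>X = Spec F[X\<^sub>v]/J\<close> at the image of the \<open>k\<close>-point \<open>p\<close>: some
  principal open neighbourhood \<open>D(h)\<close> is isomorphic over \<open>F\<close> to
  \<open>Spec F[T\<^sub>0, \<dots>, T\<^bsub>n-1\<^esub>]/(g\<^sub>0, \<dots>, g\<^bsub>c-1\<^esub>)\<close> in such a way that the Jacobian matrix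
  of \<open>g\<close> has rank \<open>c\<close> at the point \<open>q\<close> corresponding to \<open>p\<close>.  The coordinate ring of
  \<open>D(h)\<close> is presented by adjoining a variable \<open>None\<close> inverse to \<open>h\<close>.  The rank may be
  computed in \<open>k\<close> instead of the residue field.
\<close>

definition smooth_at ::
  "('f::field \<Rightarrow> 'k::field) \<Rightarrow> ('v, 'f) mpoly set \<Rightarrow> ('v \<Rightarrow> 'k) \<Rightarrow> bool" where
  "smooth_at \<iota> J p \<longleftrightarrow>
     (\<exists>h n c (g :: nat \<Rightarrow> (nat, 'f) mpoly) a b.
        let emb = psubst (\<lambda>v. pvar (Some v));
            q = (\<lambda>i. peval \<iota> (case_option (inverse (peval \<iota> p h)) p) (b i))
        in peval \<iota> p h \<noteq> 0 \<and>
           presentation_iso UNIV (emb ` J \<union> {emb h * pvar None - 1}) {..<n} (g ` {..<c}) a b \<and>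
           (\<forall>r. (\<forall>i<n. (\<Sum>j<c. r j * partial_deriv \<iota> q i (g j)) = 0) \<longrightarrow> (\<forall>j<c. r j = 0)))"


section \<open>The scheme of graded algebra structures\<close>

text \<open>
  The generic multiplication has the coordinates of the affine space as structure constants.
  The ambient space \<open>\<Oplus> Hom (V\<^sub>g \<otimes> V\<^sub>h, V\<^bsub>gh\<^esub>)\<close> is the linear subspace of
  \<open>Hom (V \<otimes> V, V)\<close> where the coordinates violating the grading vanish, so these coordinates
  are put among the equations.
\<close>

definition generic_law :: "('b, ('b \<times> 'b \<times> 'b, 'f::field) mpoly) law" where
  "generic_law i j l = pvar (i, j, l)"

definition alg_equations ::
  "('b::finite \<Rightarrow> 'g::group_add) \<Rightarrow> ('b \<Rightarrow> 'f::field) \<Rightarrow> ('f, 'g) mgen list \<Rightarrow>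
   ('b \<times> 'b \<times> 'b, 'f) mpoly set" where
  "alg_equations deg u fs =
     (let c = generic_law; e = basis_vec; e\<^sub>0 = (\<lambda>b. pconst (u b)) in
      {c i j l | i j l. deg l \<noteq> deg i + deg j} \<union>
      {mult c (mult c (e i) (e j)) (e k) l - mult c (e i) (mult c (e j) (e k)) l | i j k l. True} \<union>
      {mult c e\<^sub>0 (e i) l - e i l | i l. True} \<union>
      {mult c (e i) e\<^sub>0 l - e i l | i l. True} \<union>
      {free_eval pconst u c (gen_br f) (assign deg (gen_vars f) (map e bs)) (gen_poly f) l | f bs l.
         f \<in> set fs \<and> map deg bs = map snd (gen_vars f)})"

definition alg_ideal ::
  "('b::finite \<Rightarrow> 'g::group_add) \<Rightarrow> ('b \<Rightarrow> 'f::field) \<Rightarrow> ('f, 'g) mgen list \<Rightarrow>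
   ('b \<times> 'b \<times> 'b, 'f) mpoly set" where
  "alg_ideal deg u fs = ideal (alg_equations deg u fs)"

definition law_point :: "('b, 'k) law \<Rightarrow> 'b \<times> 'b \<times> 'b \<Rightarrow> 'k" where
  "law_point \<mu> = (\<lambda>(i, j, l). \<mu> i j l)"

definition alg_point ::
  "('f::field \<Rightarrow> 'k::field) \<Rightarrow> ('b::finite \<Rightarrow> 'g::group_add) \<Rightarrow> ('b \<Rightarrow> 'f) \<Rightarrow>
   ('f, 'g) mgen list \<Rightarrow> ('b, 'k) law \<Rightarrow> bool" where
  "alg_point \<iota> deg u fs \<mu> \<longleftrightarrow> (\<forall>p\<in>alg_ideal deg u fs. peval \<iota> (law_point \<mu>) p = 0)"


section \<open>Deformations\<close>

text \<open>
  A multiplication over \<open>k[t]/(t\<^bsup>N+1\<^esup>)\<close> is represented by structure constants in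
  \<open>k[t]\<close>, considered modulo \<open>t\<^bsup>N+1\<^esup>\<close>.
\<close>

definition law_cong :: "nat \<Rightarrow> ('b, 'k::field poly) law \<Rightarrow> ('b, 'k poly) law \<Rightarrow> bool" where
  "law_cong n M M' \<longleftrightarrow> (\<forall>i j l. monom 1 n dvd (M i j l - M' i j l))"

definition I_deformation ::
  "('f::field \<Rightarrow> 'k::field) \<Rightarrow> ('b::finite \<Rightarrow> 'g::group_add) \<Rightarrow> ('b \<Rightarrow> 'f) \<Rightarrow>
   ('f, 'g) free_alg set \<Rightarrow> ('b, 'k) law \<Rightarrow> nat \<Rightarrow> ('b, 'k poly) law \<Rightarrow> bool" where
  "I_deformation \<iota> deg u I \<mu> N M \<longleftrightarrow>
     graded_I_law (\<lambda>c. [:\<iota> c:]) (monom 1 (N + 1)) deg u I M \<and>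
     law_cong 1 M (\<lambda>i j l. [:\<mu> i j l:])"


section \<open>Cochains and the obstruction class\<close>

text \<open>
  Multilinear maps \<open>B\<^sup>\<otimes>\<^sup>n \<rightarrow> B\<close> are functions on argument lists, equal to zero by
  convention on lists of any length other than \<open>n\<close>.
\<close>

type_synonym ('b, 'k) cochain = "('b \<Rightarrow> 'k) list \<Rightarrow> 'b \<Rightarrow> 'k"

definition vscale :: "'k::field \<Rightarrow> ('b \<Rightarrow> 'k) \<Rightarrow> 'b \<Rightarrow> 'k" where
  "vscale a x = (\<lambda>b. a * x b)"

definition multilinear_maps :: "nat \<Rightarrow> ('b, 'k::field) cochain set" where
  "multilinear_maps n =
     {\<omega>. (\<forall>xs i. length xs = n \<longrightarrow> i < n \<longrightarrow>
             Vector_Spaces.linear vscale vscale (\<lambda>x. \<omega> (xs[i := x]))) \<and>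
          (\<forall>xs. length xs \<noteq> n \<longrightarrow> \<omega> xs = 0)}"

definition cochains ::
  "('f::field \<Rightarrow> 'k::field) \<Rightarrow> ('b \<Rightarrow> 'g::group_add) \<Rightarrow> ('b \<Rightarrow> 'f) \<Rightarrow> nat \<Rightarrow>
   ('b, 'k) cochain set" where
  "cochains \<iota> deg u n =
     {\<omega> \<in> multilinear_maps n.
        (\<forall>xs gs. length xs = n \<longrightarrow> list_all2 (homogeneous deg) gs xs \<longrightarrow>
           homogeneous deg (sum_list gs) (\<omega> xs)) \<and>
        (\<forall>xs. length xs = n \<longrightarrow> (\<lambda>b. \<iota> (u b)) \<in> set xs \<longrightarrow> \<omega> xs = 0)}"

definition d_Hoch :: "('b::finite, 'k::field) law \<Rightarrow> ('b, 'k) cochain \<Rightarrow> ('b, 'k) cochain" where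
  "d_Hoch \<mu> \<psi> xs = (case xs of
      [x, y, z] \<Rightarrow> \<psi> [mult \<mu> x y, z] - \<psi> [x, mult \<mu> y z] + mult \<mu> (\<psi> [x, y]) z - mult \<mu> x (\<psi> [y, z])
    | _ \<Rightarrow> 0)"

definition Q_ass :: "('b, 'k::field) cochain \<Rightarrow> ('b, 'k) cochain" where
  "Q_ass \<phi> xs = (case xs of
      [x, y, z] \<Rightarrow> \<phi> [\<phi> [x, y], z] - \<phi> [x, \<phi> [y, z]]
    | _ \<Rightarrow> 0)"

definition cochain_law :: "('b, 'k::field) cochain \<Rightarrow> ('b, 'k) law" where
  "cochain_law \<phi> i j l = \<phi> [basis_vec i, basis_vec j] l"

text \<open>
  The first differential at \<open>\<mu>\<close>, in direction \<open>\<phi>\<close>, of the evaluation of \<open>f\<close> at fixed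
  arguments as a function of the law is the derivative at \<open>t = 0\<close> of the value at
  \<open>\<mu> + t \<phi>\<close>; the second differential is the derivative of the first one, at
  \<open>\<mu> + t \<psi>\<close>.
\<close>

definition D1 ::
  "('f::field \<Rightarrow> 'r::idom) \<Rightarrow> ('b::finite \<Rightarrow> 'f) \<Rightarrow> ('g gvar word \<Rightarrow> 'g gvar bracketing) \<Rightarrow>
   ('g gvar \<Rightarrow> 'b \<Rightarrow> 'r) \<Rightarrow> ('f, 'g) free_alg \<Rightarrow> ('b, 'r) law \<Rightarrow> ('b, 'r) law \<Rightarrow> 'b \<Rightarrow> 'r" where
  "D1 \<iota> u br \<rho> f \<mu> \<phi> = (\<lambda>l. poly (pderiv
     (free_eval (\<lambda>c. [:\<iota> c:]) u (\<lambda>i j l. [:\<mu> i j l, \<phi> i j l:]) br (\<lambda>v b. [:\<rho> v b:]) f l)) 0)"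

definition D2 ::
  "('f::field \<Rightarrow> 'r::idom) \<Rightarrow> ('b::finite \<Rightarrow> 'f) \<Rightarrow> ('g gvar word \<Rightarrow> 'g gvar bracketing) \<Rightarrow>
   ('g gvar \<Rightarrow> 'b \<Rightarrow> 'r) \<Rightarrow> ('f, 'g) free_alg \<Rightarrow>
   ('b, 'r) law \<Rightarrow> ('b, 'r) law \<Rightarrow> ('b, 'r) law \<Rightarrow> 'b \<Rightarrow> 'r" where
  "D2 \<iota> u br \<rho> f \<mu> \<phi> \<psi> = (\<lambda>l. poly (pderiv
     (D1 (\<lambda>c. [:\<iota> c:]) u br (\<lambda>v b. [:\<rho> v b:]) f
        (\<lambda>i j l. [:\<mu> i j l, \<psi> i j l:]) (\<lambda>i j l. [:\<phi> i j l:]) l)) 0)"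

definition Z2 ::
  "('f::field \<Rightarrow> 'k::field) \<Rightarrow> ('b::finite \<Rightarrow> 'g::group_add) \<Rightarrow> ('b \<Rightarrow> 'f) \<Rightarrow>
   ('f, 'g) free_alg set \<Rightarrow> ('b, 'k) law \<Rightarrow> ('b, 'k) cochain set" where
  "Z2 \<iota> deg u I \<mu> =
     {\<phi> \<in> cochains \<iota> deg u 2. d_Hoch \<mu> \<phi> = 0 \<and>
        (\<forall>f\<in>I. \<forall>\<rho>. (\<forall>v. homogeneous deg (snd v) (\<rho> v)) \<longrightarrow>
           D1 \<iota> u std_br \<rho> f \<mu> (cochain_law \<phi>) = 0)}"

definition gen_D ::
  "('f::field \<Rightarrow> 'k::field) \<Rightarrow> ('b::finite \<Rightarrow> 'g::group_add) \<Rightarrow> ('b \<Rightarrow> 'f) \<Rightarrow>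
   ('f, 'g) mgen \<Rightarrow> ('b, 'k) law \<Rightarrow> ('b, 'k) cochain \<Rightarrow> ('b, 'k) cochain" where
  "gen_D \<iota> deg u f \<mu> \<psi> xs = (if length xs = length (gen_vars f)
     then D1 \<iota> u (gen_br f) (assign deg (gen_vars f) xs) (gen_poly f) \<mu> (cochain_law \<psi>) else 0)"

definition gen_Q ::
  "('f::field \<Rightarrow> 'k::field) \<Rightarrow> ('b::finite \<Rightarrow> 'g::group_add) \<Rightarrow> ('b \<Rightarrow> 'f) \<Rightarrow>
   ('f, 'g) mgen \<Rightarrow> ('b, 'k) law \<Rightarrow> ('b, 'k) cochain \<Rightarrow> ('b, 'k) cochain" where
  "gen_Q \<iota> deg u f \<mu> \<phi> xs = (if length xs = length (gen_vars f)
     then vscale (1 / 2) (D2 \<iota> u (gen_br f) (assign deg (gen_vars f) xs) (gen_poly f) \<mu>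
            (cochain_law \<phi>) (cochain_law \<phi>)) else 0)"

text \<open>
  The target \<open>C\<^sup>3 \<oplus> \<Oplus>\<^sub>j Hom (B\<^sup>\<otimes>\<^sup>m\<^sup>j, B)\<close> of \<open>\<L>\<close>, the summands being indexed by
  \<open>j < length fs\<close>, and its quotient by the image of \<open>\<L>\<close>, whose elements are cosets.
\<close>

type_synonym ('b, 'k) obs = "('b, 'k) cochain \<times> (nat \<Rightarrow> ('b, 'k) cochain)"

definition obs_space ::
  "('f::field \<Rightarrow> 'k::field) \<Rightarrow> ('b \<Rightarrow> 'g::group_add) \<Rightarrow> ('b \<Rightarrow> 'f) \<Rightarrow> ('f, 'g) mgen list \<Rightarrow>
   ('b, 'k) obs set" where
  "obs_space \<iota> deg u fs = cochains \<iota> deg u 3 \<times>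
     {\<beta>. (\<forall>j<length fs. \<beta> j \<in> multilinear_maps (length (gen_vars (fs ! j)))) \<and>
          (\<forall>j\<ge>length fs. \<beta> j = 0)}"

definition L_map ::
  "('f::field \<Rightarrow> 'k::field) \<Rightarrow> ('b::finite \<Rightarrow> 'g::group_add) \<Rightarrow> ('b \<Rightarrow> 'f) \<Rightarrow>
   ('f, 'g) mgen list \<Rightarrow> ('b, 'k) law \<Rightarrow> ('b, 'k) cochain \<Rightarrow> ('b, 'k) obs" where
  "L_map \<iota> deg u fs \<mu> \<psi> =
     (d_Hoch \<mu> \<psi>, \<lambda>j. if j < length fs then gen_D \<iota> deg u (fs ! j) \<mu> \<psi> else 0)"

definition coker_class ::
  "('f::field \<Rightarrow> 'k::field) \<Rightarrow> ('b::finite \<Rightarrow> 'g::group_add) \<Rightarrow> ('b \<Rightarrow> 'f) \<Rightarrow>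
   ('f, 'g) mgen list \<Rightarrow> ('b, 'k) law \<Rightarrow> ('b, 'k) obs \<Rightarrow> ('b, 'k) obs set" where
  "coker_class \<iota> deg u fs \<mu> \<omega> =
     {\<omega>' \<in> obs_space \<iota> deg u fs. \<omega>' - \<omega> \<in> L_map \<iota> deg u fs \<mu> ` cochains \<iota> deg u 2}"

definition ob2 ::
  "('f::field \<Rightarrow> 'k::field) \<Rightarrow> ('b::finite \<Rightarrow> 'g::group_add) \<Rightarrow> ('b \<Rightarrow> 'f) \<Rightarrow>
   ('f, 'g) mgen list \<Rightarrow> ('b, 'k) law \<Rightarrow> ('b, 'k) cochain \<Rightarrow> ('b, 'k) obs set" where
  "ob2 \<iota> deg u fs \<mu> \<phi> = coker_class \<iota> deg u fs \<mu>
     (Q_ass \<phi>, \<lambda>j. if j < length fs then gen_Q \<iota> deg u (fs ! j) \<mu> \<phi> else 0)"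

end

theory Submission
  imports Defs
begin

text \<open>
  The scheme of algebra structures represents deformations: for every commutative ring \<open>R\<close> over \<open>F\<close>
  and every \<open>m\<close> in \<open>R\<close>, its \<open>R/(m)\<close>-points are the graded unital associative laws over \<open>R/(m)\<close> that
  satisfy the whole T-ideal \<open>I\<close> (\<open>alg_equations_vanish_iff\<close>).  The equations of the scheme speak only of
  the generators of \<open>I\<close>, of their chosen bracketings, and of basis vectors.  They control all of \<open>I\<close>
  since a multilinear polynomial is determined by its values on basis vectors (\<open>multilinear_satisfied\<close>),
  associativity makes bracketings immaterial (\<open>free_eval_bracketing\<close>), and the identities of a graded
  algebra form a graded T-ideal (\<open>graded_T_ideal_satisfied\<close>).

  An \<open>I\<close>-preserving first-order deformation of \<open>B\<close> is therefore a \<open>k[t]/(t\<^sup>2)\<close>-point of the scheme whose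
  special point is \<open>B\<close>.  Near a smooth point the scheme is isomorphic to one given by equations \<open>g\<^sub>j\<close>
  whose Jacobian matrix has independent rows.  There a point modulo \<open>t\<^sup>s\<close> can be corrected in degree \<open>s\<close> so
  that it becomes a point modulo \<open>t\<^bsup>s+1\<^esup>\<close>: the correction has to solve a linear system whose matrix is the
  Jacobian (\<open>hensel_step\<close>).  Repeating this and transporting the result back gives lifts to every order
  (\<open>smooth_at_lift\<close>, \<open>first_order_deformation_lifts\<close>).

  A cocycle \<open>\<phi>\<close> defines the first-order deformation \<open>\<mu> + t \<phi>\<close> (\<open>cocycle_deformation\<close>).  Let
  \<open>\<mu> + t \<phi> + t\<^sup>2 \<phi>'\<close> be a lift modulo \<open>t\<^sup>3\<close>.  In each equation the coefficient of \<open>t\<^sup>2\<close> is the sum of the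
  first differential in direction \<open>\<phi>'\<close> and of half the second differential at \<open>(\<phi>, \<phi>)\<close>, so the quadratic
  expression in \<open>\<phi>\<close> that represents the obstruction is the image of the normalized cochain \<open>- \<phi>'\<close> under
  \<open>\<L>\<close> (\<open>second_order_deformation_solves\<close>), and its class in the cokernel is zero.  The formulas
  for these coefficients come from the naturality of evaluation in the coefficient ring
  (\<open>free_eval_hom\<close>), applied to substitutions such as \<open>s = r t\<^sup>2\<close> and \<open>\<tau> = s + t\<close> in polynomial rings over \<open>k\<close>.
\<close>

section \<open>Ring homomorphisms and evaluation of polynomials\<close>

lemma unital_ring_hom_simps:
  assumes "unital_ring_hom h"
  shows "h 0 = 0" "h 1 = 1" "h (x + y) = h x + h y" "h (x * y) = h x * h y"
    "h (- x) = - h x" "h (x - y) = h x - h y" "h (x ^ n) = h x ^ n"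
proof -
  have 1: "h 1 = 1" and add: "h (x + y) = h x + h y" and mult: "h (x * y) = h x * h y" for x y
    using assms by (auto simp: unital_ring_hom_def)
  show 0: "h 0 = 0" using add[of 0 0] by simp
  have neg: "h (- x) = - h x" for x
    using add[of x "- x"] 0 by (simp add: eq_neg_iff_add_eq_0 add.commute)
  show "h (- x) = - h x" by (rule neg)
  show "h (x - y) = h x - h y" using add[of x "- y"] neg by simp
  show "h 1 = 1" "h (x + y) = h x + h y" "h (x * y) = h x * h y" by (fact 1 add mult)+
  show "h (x ^ n) = h x ^ n" by (induction n) (simp_all add: 1 mult)
qed

lemma unital_ring_hom_sum:
  assumes "unital_ring_hom h" shows "h (sum f A) = (\<Sum>x\<in>A. h (f x))"
  by (induction A rule: infinite_finite_induct) (simp_all add: unital_ring_hom_simps[OF assms])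

lemma unital_ring_hom_prod:
  fixes h :: "'a::comm_ring_1 \<Rightarrow> 'b::comm_ring_1"
  assumes "unital_ring_hom h" shows "h (prod f A) = (\<Prod>x\<in>A. h (f x))"
  by (induction A rule: infinite_finite_induct) (simp_all add: unital_ring_hom_simps[OF assms])

lemma unital_ring_hom_comp:
  "unital_ring_hom h \<Longrightarrow> unital_ring_hom h' \<Longrightarrow> unital_ring_hom (\<lambda>x. h' (h x))"
  by (simp add: unital_ring_hom_def)

lemma unital_ring_hom_const_poly: "unital_ring_hom (\<lambda>c. [:c:])"
  by (simp add: unital_ring_hom_def one_pCons)

lemma unital_ring_hom_const_poly_comp:
  "unital_ring_hom \<iota> \<Longrightarrow> unital_ring_hom (\<lambda>c. [:\<iota> c:])"
  by (rule unital_ring_hom_comp[OF _ unital_ring_hom_const_poly])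

lemma unital_ring_hom_poly: "unital_ring_hom (\<lambda>p. poly p (a :: 'a::comm_ring_1))"
  by (simp add: unital_ring_hom_def)

lemma poly_mapping_add_induct [case_names zero single add]:
  assumes "P 0" "\<And>k c. P (Poly_Mapping.single k c)" "\<And>f g. P f \<Longrightarrow> P g \<Longrightarrow> P (f + g)"
  shows "P (f :: 'a \<Rightarrow>\<^sub>0 'b::monoid_add)"
proof (induction f rule: update_induct)
  case const show ?case by (fact assms(1))
next
  case (update f a b)
  have "Poly_Mapping.update a b f = Poly_Mapping.single a b + f"
    using update(1) by (intro poly_mapping_eqI)
      (auto simp: lookup_update lookup_add lookup_single when_def in_keys_iff)
  with assms update show ?case by metis
qed

lemma keys_sum_superset:
  assumes "finite A" "Poly_Mapping.keys f \<subseteq> A" "\<And>k. g k 0 = (0::'c::comm_monoid_add)"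
  shows "(\<Sum>k\<in>Poly_Mapping.keys f. g k (Poly_Mapping.lookup f k)) = (\<Sum>k\<in>A. g k (Poly_Mapping.lookup f k))"
  using assms by (intro sum.mono_neutral_left) (auto simp: in_keys_iff)

text \<open>
  Evaluations, both of polynomials and of elements of the free algebra, are sums over the support of
  the coefficient function.  Supports are not additive, and this is why additivity of evaluations
  requires an argument: the three sums are extended to the union of the supports.
\<close>

lemma keys_sum_add:
  assumes "\<And>k. g k 0 = (0::'c::comm_monoid_add)" "\<And>k a b. g k (a + b) = g k a + g k b"
  shows "(\<Sum>k\<in>Poly_Mapping.keys (p + q). g k (Poly_Mapping.lookup (p + q) k)) =
    (\<Sum>k\<in>Poly_Mapping.keys p. g k (Poly_Mapping.lookup p k)) + (\<Sum>k\<in>Poly_Mapping.keys q. g k (Poly_Mapping.lookup q k))"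
proof -
  let ?A = "Poly_Mapping.keys p \<union> Poly_Mapping.keys q"
  have *: "(\<Sum>k\<in>Poly_Mapping.keys f. g k (Poly_Mapping.lookup f k)) = (\<Sum>k\<in>?A. g k (Poly_Mapping.lookup f k))"
    if "Poly_Mapping.keys f \<subseteq> ?A" for f
    using that by (intro keys_sum_superset) (simp_all add: assms(1))
  show ?thesis
    unfolding *[OF Poly_Mapping.keys_add] *[OF Un_upper1] *[OF Un_upper2]
    by (simp add: lookup_add assms(2) sum.distrib)
qed

lemma keys_sum_single:
  assumes "g k 0 = (0::'c::comm_monoid_add)"
  shows "(\<Sum>j\<in>Poly_Mapping.keys (Poly_Mapping.single k c). g j (Poly_Mapping.lookup (Poly_Mapping.single k c) j)) = g k c"
  using assms by (cases "c = 0") simp_all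

text \<open>
  Polynomials are generated as a ring by constants and variables.  Claims that are stable under sums
  and products, such as the first-order Taylor formula below, need to be checked for these only.
\<close>

lemma mpoly_induct [case_names const var add mult]:
  fixes p :: "('v, 'f::comm_ring_1) mpoly"
  assumes "\<And>c. P (pconst c)" "\<And>v. P (pvar v)"
    "\<And>p q. P p \<Longrightarrow> P q \<Longrightarrow> P (p + q)" "\<And>p q. P p \<Longrightarrow> P q \<Longrightarrow> P (p * q)"
  shows "P p"
proof (induction p rule: poly_mapping_add_induct)
  case zero
  then show ?case using assms(1)[of 0] by (simp add: pconst_def)
next
  case (single m c)
  have one: "P 1" using assms(1)[of 1] by (simp add: pconst_def)
  have pow: "P (pvar v ^ n)" for v n
    by (induction n) (auto simp: one intro: assms)
  have pw: "Poly_Mapping.single (Poly_Mapping.single v n) 1 = (pvar v ^ n :: ('v, 'f) mpoly)" for v n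
  proof (induction n)
    case (Suc n)
    have "Poly_Mapping.single v (Suc n) = Poly_Mapping.single v 1 + Poly_Mapping.single v n"
      by (simp add: single_add[symmetric])
    then have "Poly_Mapping.single (Poly_Mapping.single v (Suc n)) 1 =
        Poly_Mapping.single (Poly_Mapping.single v 1) 1 * Poly_Mapping.single (Poly_Mapping.single v n) (1::'f)"
      by (simp add: mult_single)
    then show ?case unfolding Suc.IH power_Suc by (simp only: pvar_def)
  qed (simp add: pvar_def)
  have "P (Poly_Mapping.single m 1)"
  proof (induction m rule: poly_mapping_add_induct)
    case zero then show ?case using one by simp
  next
    case (single v n) show ?case using pow[of v n] by (simp add: pw)
  next
    case (add m n)
    have "Poly_Mapping.single (m + n) 1 = Poly_Mapping.single m 1 * (Poly_Mapping.single n 1 :: ('v, 'f) mpoly)"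
      by (simp add: mult_single)
    with add assms(4) show ?case by metis
  qed
  moreover have "Poly_Mapping.single m c = pconst c * Poly_Mapping.single m 1"
    by (simp add: pconst_def mult_single)
  ultimately show ?case using assms(1,4) by metis
next
  case (add f g) then show ?case by (rule assms(3))
qed

definition monom_value :: "('v \<Rightarrow> 'r::comm_ring_1) \<Rightarrow> ('v \<Rightarrow>\<^sub>0 nat) \<Rightarrow> 'r" where
  "monom_value x m = (\<Prod>v\<in>Poly_Mapping.keys m. x v ^ Poly_Mapping.lookup m v)"

lemma monom_value_add: "monom_value x (m + n) = monom_value x m * monom_value x n"
proof -
  let ?A = "Poly_Mapping.keys m \<union> Poly_Mapping.keys n"
  have *: "monom_value x l = (\<Prod>v\<in>?A. x v ^ Poly_Mapping.lookup l v)" if "Poly_Mapping.keys l \<subseteq> ?A" for l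
    unfolding monom_value_def using that
    by (intro prod.mono_neutral_left) (auto simp: in_keys_iff)
  show ?thesis
    using Poly_Mapping.keys_add[of m n] by (simp add: * lookup_add power_add prod.distrib)
qed

lemma peval_add:
  assumes "unital_ring_hom \<iota>"
  shows "peval \<iota> x (p + q) = peval \<iota> x p + peval \<iota> x q"
  unfolding peval_def monom_value_def[symmetric]
  by (rule keys_sum_add[where g = "\<lambda>m c. \<iota> c * monom_value x m"])
    (simp_all add: unital_ring_hom_simps[OF assms] algebra_simps)

lemma peval_single:
  assumes "unital_ring_hom \<iota>"
  shows "peval \<iota> x (Poly_Mapping.single m c) = \<iota> c * monom_value x m"
  unfolding peval_def monom_value_def[symmetric]
  by (rule keys_sum_single[where g = "\<lambda>m c. \<iota> c * monom_value x m"])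
    (simp_all add: unital_ring_hom_simps[OF assms])

lemma peval_0: "peval \<iota> x 0 = 0"
  by (simp add: peval_def)

lemma peval_mult:
  assumes "unital_ring_hom \<iota>"
  shows "peval \<iota> x (p * q) = peval \<iota> x p * peval \<iota> x q"
proof (induction p rule: poly_mapping_add_induct)
  case (single m c)
  show ?case
    by (induction q rule: poly_mapping_add_induct)
      (simp_all add: peval_0 peval_single[OF assms] mult_single monom_value_add distrib_left
        peval_add[OF assms] unital_ring_hom_simps[OF assms])
qed (simp_all add: peval_0 distrib_right peval_add[OF assms])

lemma peval_pconst: "unital_ring_hom \<iota> \<Longrightarrow> peval \<iota> x (pconst c) = \<iota> c"
  by (simp add: pconst_def peval_single monom_value_def)

lemma peval_pvar: "unital_ring_hom \<iota> \<Longrightarrow> peval \<iota> x (pvar v) = x v"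
  by (simp add: pvar_def peval_single monom_value_def unital_ring_hom_simps)

lemma unital_ring_hom_peval:
  assumes "unital_ring_hom \<iota>" shows "unital_ring_hom (peval \<iota> x)"
  using peval_pconst[OF assms, of x 1]
  by (simp add: unital_ring_hom_def peval_add[OF assms] peval_mult[OF assms]
      unital_ring_hom_simps[OF assms] pconst_def)

text \<open>
  Naturality.  With the ring homomorphism \<open>t \<mapsto> 0\<close> it computes the constant term of the value at a
  point over \<open>k[t]\<close>, and with an evaluation as the homomorphism it computes the value of a substitution.
\<close>

lemma peval_hom:
  assumes "unital_ring_hom h"
  shows "h (peval \<iota> x p) = peval (\<lambda>c. h (\<iota> c)) (\<lambda>v. h (x v)) p"
  unfolding peval_def
  by (simp add: unital_ring_hom_sum[OF assms] unital_ring_hom_prod[OF assms] unital_ring_hom_simps[OF assms])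

lemma peval_psubst:
  assumes "unital_ring_hom \<iota>"
  shows "peval \<iota> x (psubst a p) = peval \<iota> (\<lambda>v. peval \<iota> x (a v)) p"
  using peval_hom[OF unital_ring_hom_peval[OF assms], of x pconst a p]
  by (simp add: peval_pconst[OF assms])

lemma peval_dvd_cong:
  fixes x y :: "'v \<Rightarrow> 'r::comm_ring_1"
  assumes "unital_ring_hom \<iota>" "\<And>v. m dvd x v - y v"
  shows "m dvd peval \<iota> x p - peval \<iota> y p"
proof (induction p rule: mpoly_induct)
  case (mult p q)
  have "peval \<iota> x (p * q) - peval \<iota> y (p * q) =
    (peval \<iota> x p - peval \<iota> y p) * peval \<iota> x q + peval \<iota> y p * (peval \<iota> x q - peval \<iota> y q)"
    by (simp add: peval_mult[OF assms(1)] algebra_simps)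
  with mult show ?case by (simp add: dvd_add)
next
  case (add p q)
  have "peval \<iota> x (p + q) - peval \<iota> y (p + q) =
    (peval \<iota> x p - peval \<iota> y p) + (peval \<iota> x q - peval \<iota> y q)"
    by (simp add: peval_add[OF assms(1)] algebra_simps)
  with add show ?case by (simp add: dvd_add)
qed (use assms in \<open>simp_all add: peval_pconst peval_pvar\<close>)

lemma module_self: "module ((*) :: 'a::comm_ring_1 \<Rightarrow> 'a \<Rightarrow> 'a)"
  by standard (simp_all add: algebra_simps)

lemma dvd_peval_ideal:
  assumes "unital_ring_hom \<iota>" "\<And>p. p \<in> S \<Longrightarrow> m dvd peval \<iota> x p" "p \<in> ideal S"
  shows "m dvd peval \<iota> x p"
  using assms(3) unfolding ideal_def
  by (induction rule: module.span_induct_alt[OF module_self, consumes 1])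
    (simp_all add: peval_0 peval_add[OF assms(1)] peval_mult[OF assms(1)] assms(2) dvd_add)

lemma in_ideal: "p \<in> S \<Longrightarrow> p \<in> ideal S"
  unfolding ideal_def by (rule module.span_base[OF module_self])

section \<open>Infinitesimal lifting at smooth points\<close>

text \<open>
  A matrix with independent rows defines a surjective map.  By induction on the number of rows, it is
  enough to find a vector \<open>d\<close> in the kernel of the first \<open>c\<close> rows on which row \<open>c\<close> does not vanish.  The
  induction hypothesis yields a system \<open>E\<close> dual to the first \<open>c\<close> rows, and projecting along \<open>E\<close> moves
  every basis vector into this kernel.  If row \<open>c\<close> vanished on the kernel, this projection would express
  row \<open>c\<close> as a combination of the other rows.
\<close>

lemma solve_independent_rows:
  fixes A :: "nat \<Rightarrow> nat \<Rightarrow> 'k::field"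
  assumes "\<And>r. (\<forall>i<n. (\<Sum>j<c. r j * A i j) = 0) \<Longrightarrow> \<forall>j<c. r j = 0"
  shows "\<exists>d. \<forall>j<c. (\<Sum>i<n. d i * A i j) = b j"
  using assms
proof (induction c arbitrary: b)
  case 0
  then show ?case by simp
next
  case (Suc c)
  have indep: "\<forall>j<c. r j = 0" if "\<forall>i<n. (\<Sum>j<c. r j * A i j) = 0" for r
  proof -
    have *: "(\<Sum>j<Suc c. (if j < c then r j else 0) * A i j) = (\<Sum>j<c. r j * A i j)" for i
      by simp
    have "\<forall>j<Suc c. (if j < c then r j else 0) = 0"
      by (rule Suc.prems) (use that in \<open>simp only: *\<close>)
    then show ?thesis by (metis less_SucI)
  qed
  have "\<forall>j. \<exists>d. \<forall>l<c. (\<Sum>i<n. d i * A i l) = (if l = j then 1 else 0)"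
    by (rule allI, rule Suc.IH[OF indep])
  from choice[OF this] obtain E
    where E: "\<And>j l. l < c \<Longrightarrow> (\<Sum>i<n. E j i * A i l) = (if l = j then 1 else 0)"
    by blast
  define L where "L d j = (\<Sum>i<n. d i * A i j)" for d :: "nat \<Rightarrow> 'k" and j
  have LE: "L (E j) l = (if l = j then 1 else 0)" if "l < c" for j l
    using E[OF that] by (simp add: L_def)
  have "\<exists>d. (\<forall>j<c. L d j = 0) \<and> L d c \<noteq> 0"
  proof (rule ccontr)
    assume no: "\<not> ?thesis"
    \<comment> \<open>the relation that would express row \<open>c\<close> through the others\<close>
    define r where "r j = (if j < c then L (E j) c else -1)" for j
    have "(\<Sum>j<Suc c. r j * A i j) = 0" if "i < n" for i
    proof -
      \<comment> \<open>the \<open>i\<close>-th basis vector, projected along \<open>E\<close> into the kernel of the first \<open>c\<close> rows\<close>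
      define d where "d i' = (if i' = i then 1 else 0) - (\<Sum>j<c. A i j * E j i')" for i'
      have Ld: "L d l = A i l - (\<Sum>j<c. A i j * L (E j) l)" for l
      proof -
        have "L d l = (\<Sum>i'<n. (if i' = i then A i' l else 0)) - (\<Sum>i'<n. \<Sum>j<c. A i j * E j i' * A i' l)"
          unfolding L_def d_def
          by (simp add: left_diff_distrib sum_subtractf sum_distrib_right if_distrib[of "\<lambda>x. x * _"] cong: if_cong)
        also have "(\<Sum>i'<n. \<Sum>j<c. A i j * E j i' * A i' l) = (\<Sum>j<c. A i j * L (E j) l)"
          unfolding L_def sum_distrib_left mult.assoc by (rule sum.swap)
        finally show ?thesis using that by simp
      qed
      have "L d l = 0" if "l < c" for l
        using that by (simp add: Ld LE if_distrib cong: if_cong)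
      with no have "L d c = 0" by blast
      then show ?thesis by (simp add: Ld r_def mult.commute)
    qed
    then have "r c = 0" using Suc.prems[of r] by blast
    then show False by (simp add: r_def)
  qed
  then obtain d where d: "\<And>j. j < c \<Longrightarrow> L d j = 0" "L d c \<noteq> 0" by blast
  obtain d0 where d0: "\<And>j. j < c \<Longrightarrow> L d0 j = b j" using Suc.IH[OF indep, of b] unfolding L_def by blast
  define t where "t = (b c - L d0 c) / L d c"
  define e where "e i = d0 i + t * d i" for i
  have Le: "L e j = L d0 j + t * L d j" for j
    unfolding e_def L_def distrib_right sum.distrib sum_distrib_left mult.assoc ..
  have "L e j = b j" if "j < Suc c" for j
    using that d d0 by (cases "j = c") (simp_all add: Le t_def)
  then show ?case unfolding L_def by blast
qed

lemma partial_deriv_simps: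
  assumes "unital_ring_hom \<iota>"
  shows "partial_deriv \<iota> q i (pconst c) = 0"
    "partial_deriv \<iota> q i (pvar v) = (if v = i then 1 else 0)"
    "partial_deriv \<iota> q i (p + p') = partial_deriv \<iota> q i p + partial_deriv \<iota> q i p'"
    "partial_deriv \<iota> q i (p * p') =
       partial_deriv \<iota> q i p * peval \<iota> q p' + peval \<iota> q p * partial_deriv \<iota> q i p'"
proof -
  note h = unital_ring_hom_const_poly_comp[OF assms]
  let ?P = "peval (\<lambda>c. [:\<iota> c:]) (\<lambda>w. if w = i then [:q w, 1:] else [:q w:])"
  have 0: "poly (?P p) 0 = peval \<iota> q p" for p
    by (subst peval_hom[OF unital_ring_hom_poly])
      (auto intro!: arg_cong[where f = "\<lambda>q. peval \<iota> q p"])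
  show "partial_deriv \<iota> q i (pconst c) = 0"
    "partial_deriv \<iota> q i (pvar v) = (if v = i then 1 else 0)"
    "partial_deriv \<iota> q i (p + p') = partial_deriv \<iota> q i p + partial_deriv \<iota> q i p'"
    by (simp_all add: partial_deriv_def peval_pconst[OF h] peval_pvar[OF h] peval_add[OF h]
      pderiv_add pderiv_pCons)
  show "partial_deriv \<iota> q i (p * p') =
       partial_deriv \<iota> q i p * peval \<iota> q p' + peval \<iota> q p * partial_deriv \<iota> q i p'"
    by (simp add: partial_deriv_def peval_mult[OF h] pderiv_mult 0)
qed

text \<open>
  Both sides are compatible with sums and products modulo \<open>t\<^bsup>s+1\<^esup>\<close>: the directional derivative is a
  derivation over the evaluation at the point \<open>Q(0)\<close>, and the product of two corrections of order \<open>s\<close> has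
  order \<open>2s \<ge> s + 1\<close>.  The direction \<open>d\<close> vanishes beyond \<open>n\<close> because only the first \<open>n\<close> partial
  derivatives occur in the sum.
\<close>

lemma taylor_first_order:
  fixes Q :: "nat \<Rightarrow> 'k::field poly"
  assumes \<iota>: "unital_ring_hom \<iota>" and s: "1 \<le> s"
    and d: "\<And>i. n \<le> i \<Longrightarrow> d i = 0"
  shows "monom 1 (s + 1) dvd
    peval (\<lambda>c. [:\<iota> c:]) (\<lambda>i. Q i + monom (d i) s) p
    - (peval (\<lambda>c. [:\<iota> c:]) Q p + monom (\<Sum>i<n. d i * partial_deriv \<iota> (\<lambda>i. poly (Q i) 0) i p) s)"
proof (induction p rule: mpoly_induct)
  note h = unital_ring_hom_const_poly_comp[OF \<iota>]
  note pd = partial_deriv_simps[OF \<iota>]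
  let ?q = "\<lambda>i. poly (Q i) 0"
  define D where "D p = (\<Sum>i<n. d i * partial_deriv \<iota> ?q i p)" for p
  define E where "E = peval (\<lambda>c. [:\<iota> c:]) Q"
  define E' where "E' = peval (\<lambda>c. [:\<iota> c:]) (\<lambda>i. Q i + monom (d i) s)"
  have E0: "coeff (E p) 0 = peval \<iota> ?q p" for p
    unfolding E_def poly_0_coeff_0[symmetric]
    by (subst peval_hom[OF unital_ring_hom_poly]) simp
  {
    case (const c)
    then show ?case by (simp add: peval_pconst[OF h] pd)
  next
    case (var v)
    show ?case using d[of v]
      by (cases "v < n") (simp_all add: peval_pvar[OF h] pd if_distrib cong: if_cong)
  next
    case (add p q)
    have Da: "D (p + q) = D p + D q"
      by (simp add: D_def pd distrib_left sum.distrib)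
    have diff: "E' (p + q) - (E (p + q) + monom (D (p + q)) s) =
      (E' p - (E p + monom (D p) s)) + (E' q - (E q + monom (D q) s))"
      by (simp add: E_def E'_def peval_add[OF h] Da flip: add_monom)
    show ?case
      using add unfolding E_def[symmetric] E'_def[symmetric] D_def[symmetric] diff by (rule dvd_add)
  next
    case (mult p q)
    have Dm: "D (p * q) = D p * coeff (E q) 0 + coeff (E p) 0 * D q"
    proof -
      have "D (p * q) = (\<Sum>i<n. d i * partial_deriv \<iota> ?q i p * coeff (E q) 0 + coeff (E p) 0 * (d i * partial_deriv \<iota> ?q i q))"
        unfolding D_def E0 pd(4) by (rule sum.cong) (simp_all only: distrib_left mult_ac)
      then show ?thesis
        by (simp only: sum.distrib D_def sum_distrib_left sum_distrib_right)
    qed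
    have diff: "E' (p * q) - (E (p * q) + monom (D (p * q)) s) =
        (E' p - (E p + monom (D p) s)) * E' q
      + (E p + monom (D p) s) * (E' q - (E q + monom (D q) s))
      + (monom (D p) s * E q + E p * monom (D q) s + monom (D p) s * monom (D q) s - monom (D (p * q)) s)"
      by (simp add: E_def E'_def peval_mult[OF h] algebra_simps)
    have "monom 1 (s + 1) dvd (monom (D p) s * E q + E p * monom (D q) s + monom (D p) s * monom (D q) s - monom (D (p * q)) s)"
      unfolding monom_1_dvd_iff'
    proof (intro allI impI)
      fix i assume "i < s + 1"
      then consider "i < s" | "i = s" by linarith
      then show "coeff (monom (D p) s * E q + E p * monom (D q) s + monom (D p) s * monom (D q) s - monom (D (p * q)) s) i = 0"
        using s unfolding mult.commute[of "E p" "monom (D q) s"] Dm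
          by cases (simp_all add: coeff_monom_mult mult.commute[of "D q"])
    qed
    then show ?case
      using mult unfolding E_def[symmetric] E'_def[symmetric] D_def[symmetric] diff
      by (intro dvd_add dvd_mult dvd_mult2)
  }
qed

text \<open>
  A Newton step.  Adding \<open>d t\<^sup>s\<close> to the point changes the coefficient of \<open>t\<^sup>s\<close> in \<open>g\<^sub>j\<close> by the derivative
  of \<open>g\<^sub>j\<close> at \<open>Q(0)\<close> in direction \<open>d\<close>; since the Jacobian matrix at \<open>Q(0)\<close> has independent rows, all
  these coefficients can be cancelled at the same time.
\<close>

lemma hensel_step:
  fixes Q :: "nat \<Rightarrow> 'k::field poly" and g :: "nat \<Rightarrow> (nat, 'f::field) mpoly"
  assumes \<iota>: "unital_ring_hom \<iota>" and s: "1 \<le> s"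
    and indep: "\<And>r. (\<forall>i<n. (\<Sum>j<c. r j * partial_deriv \<iota> (\<lambda>i. poly (Q i) 0) i (g j)) = 0) \<Longrightarrow> \<forall>j<c. r j = 0"
    and Q: "\<And>j. j < c \<Longrightarrow> monom 1 s dvd peval (\<lambda>c. [:\<iota> c:]) Q (g j)"
  shows "\<exists>Q'. (\<forall>i. monom 1 s dvd Q' i - Q i) \<and> (\<forall>j<c. monom 1 (s + 1) dvd peval (\<lambda>c. [:\<iota> c:]) Q' (g j))"
proof -
  have "\<exists>d. \<forall>j<c. (\<Sum>i<n. d i * partial_deriv \<iota> (\<lambda>i. poly (Q i) 0) i (g j)) =
      - coeff (peval (\<lambda>c. [:\<iota> c:]) Q (g j)) s"
    by (rule solve_independent_rows) (rule indep)
  then obtain d0 where d0: "\<And>j. j < c \<Longrightarrow> (\<Sum>i<n. d0 i * partial_deriv \<iota> (\<lambda>i. poly (Q i) 0) i (g j)) =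
      - coeff (peval (\<lambda>c. [:\<iota> c:]) Q (g j)) s"
    by blast
  define d where "d i = (if i < n then d0 i else 0)" for i
  have d: "(\<Sum>i<n. d i * partial_deriv \<iota> (\<lambda>i. poly (Q i) 0) i (g j)) =
      - coeff (peval (\<lambda>c. [:\<iota> c:]) Q (g j)) s" if "j < c" for j
    using d0[OF that] by (simp add: d_def)
  have "monom 1 (s + 1) dvd peval (\<lambda>c. [:\<iota> c:]) (\<lambda>i. Q i + monom (d i) s) (g j)" if "j < c" for j
  proof -
    have "monom 1 (s + 1) dvd peval (\<lambda>c. [:\<iota> c:]) Q (g j) + monom (- coeff (peval (\<lambda>c. [:\<iota> c:]) Q (g j)) s) s"
      using Q[OF that] unfolding monom_1_dvd_iff' by (auto simp: less_Suc_eq)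
    from dvd_add[OF taylor_first_order[OF \<iota> s, where d = d and n = n and Q = Q and p = "g j"] this]
    show ?thesis by (simp add: d_def d0[OF that] minus_monom[symmetric])
  qed
  moreover have "monom 1 s dvd (Q i + monom (d i) s) - Q i" for i
    by (simp add: monom_1_dvd_iff')
  ultimately show ?thesis by (intro exI[of _ "\<lambda>i. Q i + monom (d i) s"]) simp
qed

lemma hensel_lift:
  fixes Q :: "nat \<Rightarrow> 'k::field poly" and g :: "nat \<Rightarrow> (nat, 'f::field) mpoly"
  assumes \<iota>: "unital_ring_hom \<iota>" and s: "1 \<le> s"
    and indep: "\<And>r. (\<forall>i<n. (\<Sum>j<c. r j * partial_deriv \<iota> (\<lambda>i. poly (Q i) 0) i (g j)) = 0) \<Longrightarrow> \<forall>j<c. r j = 0"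
    and Q: "\<And>j. j < c \<Longrightarrow> monom 1 s dvd peval (\<lambda>c. [:\<iota> c:]) Q (g j)"
  shows "\<exists>Q'. (\<forall>i. monom 1 s dvd Q' i - Q i) \<and> (\<forall>j<c. monom 1 (s + N) dvd peval (\<lambda>c. [:\<iota> c:]) Q' (g j))"
proof (induction N)
  case 0
  show ?case using Q by (intro exI[of _ Q]) simp
next
  case (Suc N)
  then obtain Q' where Q': "\<And>i. monom 1 s dvd Q' i - Q i"
    "\<And>j. j < c \<Longrightarrow> monom 1 (s + N) dvd peval (\<lambda>c. [:\<iota> c:]) Q' (g j)" by blast
  have "coeff (Q' i - Q i) 0 = 0" for i using Q'(1)[of i] s unfolding monom_1_dvd_iff' by auto
  then have "poly (Q' i) 0 = poly (Q i) 0" for i by (simp add: poly_0_coeff_0)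
  then obtain Q'' where Q'': "\<And>i. monom 1 (s + N) dvd Q'' i - Q' i"
    "\<And>j. j < c \<Longrightarrow> monom 1 (s + N + 1) dvd peval (\<lambda>c. [:\<iota> c:]) Q'' (g j)"
    using hensel_step[OF \<iota>, where s = "s + N" and n = n and c = c and Q = Q' and g = g] s indep Q'(2)
    by auto
  have "monom 1 s dvd (Q'' i - Q' i) + (Q' i - Q i)" for i
    by (intro dvd_add Q'(1) dvd_trans[OF _ Q''(1)]) (simp add: monom_1_dvd_iff')
  with Q''(2) show ?case by (intro exI[of _ Q'']) simp
qed

text \<open>
  An inverse modulo \<open>t\<^sup>s\<close> is corrected in degree \<open>s\<close> to one modulo \<open>t\<^bsup>s+1\<^esup>\<close>.  This extends a point of a
  scheme to the principal open subset where a function invertible at the special point is inverted.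
\<close>

lemma invertible_mod_monom:
  fixes p :: "'k::field poly"
  assumes "coeff p 0 \<noteq> 0"
  shows "\<exists>r. coeff r 0 = inverse (coeff p 0) \<and> monom 1 s dvd p * r - 1"
proof (induction s)
  case 0
  show ?case by (intro exI[of _ "[:inverse (coeff p 0):]"]) (simp add: monom_0 flip: one_pCons)
next
  case (Suc s)
  then obtain r where r: "coeff r 0 = inverse (coeff p 0)" "monom 1 s dvd p * r - 1" by blast
  show ?case
  proof (cases "s = 0")
    case True
    with r assms show ?thesis by (intro exI[of _ r]) (auto simp: monom_1_dvd_iff' coeff_mult)
  next
    case False
    define r' where "r' = r + monom (- coeff (p * r - 1) s / coeff p 0) s"
    have "monom 1 (Suc s) dvd p * r' - 1"
      unfolding monom_1_dvd_iff'
    proof (intro allI impI)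
      fix i assume i: "i < Suc s"
      have "coeff (p * r' - 1) i = coeff (p * r - 1) i + coeff (monom (- coeff (p * r - 1) s / coeff p 0) s * p) i"
        by (simp add: r'_def distrib_left mult.commute)
      also have "\<dots> = 0"
        using r(2) i assms unfolding monom_1_dvd_iff' coeff_monom_mult by (auto simp: less_Suc_eq)
      finally show "coeff (p * r' - 1) i = 0" .
    qed
    moreover have "coeff r' 0 = inverse (coeff p 0)" using r(1) False by (simp add: r'_def)
    ultimately show ?thesis by blast
  qed
qed

text \<open>
  Infinitesimal lifting at a smooth point.  The point \<open>P\<close>, known modulo \<open>t\<^sup>s\<close>, lies in the principal open
  neighbourhood and is carried by \<open>b\<close> to a point of the standard smooth scheme, where the Newton
  iteration lifts it to any order; \<open>a\<close> carries the lift back.  Since \<open>a\<close> and \<open>b\<close> are mutually inverse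
  modulo the two ideals, the outcome agrees with \<open>P\<close> modulo \<open>t\<^sup>s\<close>.
\<close>

lemma smooth_at_lift:
  fixes \<iota> :: "'f::field \<Rightarrow> 'k::field" and J :: "('v, 'f) mpoly set"
    and p :: "'v \<Rightarrow> 'k" and P :: "'v \<Rightarrow> 'k poly"
  assumes \<iota>: "unital_ring_hom \<iota>" and smooth: "smooth_at \<iota> J p" and s: "1 \<le> s"
    and P0: "\<And>v. coeff (P v) 0 = p v"
    and P: "\<And>f. f \<in> J \<Longrightarrow> monom 1 s dvd peval (\<lambda>c. [:\<iota> c:]) P f"
  shows "\<exists>P'. (\<forall>v. monom 1 s dvd P' v - P v) \<and>
    (\<forall>f\<in>J. monom 1 (s + N) dvd peval (\<lambda>c. [:\<iota> c:]) P' f)"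
proof -
  note h = unital_ring_hom_const_poly_comp[OF \<iota>]
  define emb :: "('v, 'f) mpoly \<Rightarrow> ('v option, 'f) mpoly" where "emb = psubst (\<lambda>v. pvar (Some v))"
  from smooth obtain h n c and g :: "nat \<Rightarrow> (nat, 'f) mpoly" and a b where
    hp: "peval \<iota> p h \<noteq> 0" and
    iso: "presentation_iso UNIV (emb ` J \<union> {emb h * pvar None - 1}) {..<n} (g ` {..<c}) a b" and
    jac: "\<And>r. (\<forall>i<n. (\<Sum>j<c. r j * partial_deriv \<iota>
        (\<lambda>i. peval \<iota> (case_option (inverse (peval \<iota> p h)) p) (b i)) i (g j)) = 0) \<Longrightarrow> \<forall>j<c. r j = 0"
    unfolding smooth_at_def Let_def emb_def[symmetric] by blast
  let ?S = "emb ` J \<union> {emb h * pvar None - 1}" and ?T = "g ` {..<c}"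
  let ?ev = "peval (\<lambda>c. [:\<iota> c:])"
  have ev_emb: "?ev X (emb f) = ?ev (\<lambda>v. X (Some v)) f" for X f
    unfolding emb_def by (simp add: peval_psubst[OF h] peval_pvar[OF h])
  have ev0: "coeff (?ev X f) 0 = peval \<iota> (\<lambda>v. coeff (X v) 0) f" for X :: "'w \<Rightarrow> 'k poly" and f
    using peval_hom[OF unital_ring_hom_poly, of "\<lambda>c. [:\<iota> c:]" X f 0] by (simp add: poly_0_coeff_0)
  have h0: "coeff (?ev P h) 0 = peval \<iota> p h" by (simp add: ev0 P0)
  then obtain r where r: "coeff r 0 = inverse (peval \<iota> p h)" "monom 1 s dvd ?ev P h * r - 1"
    using invertible_mod_monom[of "?ev P h" s] hp by auto
  \<comment> \<open>the point of the principal open neighbourhood over \<open>P\<close>\<close>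
  define X where "X = case_option r P"
  have XS: "monom 1 s dvd ?ev X f" if "f \<in> ?S" for f
    using that P r(2)
    by (auto simp: ev_emb X_def peval_mult[OF h] peval_pvar[OF h]
        unital_ring_hom_simps[OF unital_ring_hom_peval[OF h]])
  have XI: "monom 1 s dvd ?ev X f" if "f \<in> ideal ?S" for f
    using XS that by (rule dvd_peval_ideal[OF h])
  \<comment> \<open>its coordinates in the standard smooth presentation\<close>
  define Q where "Q i = ?ev X (b i)" for i
  have X0: "(\<lambda>v. coeff (X v) 0) = case_option (inverse (peval \<iota> p h)) p"
    by (auto simp: X_def r P0 split: option.split)
  have Q0: "(\<lambda>i. poly (Q i) 0) = (\<lambda>i. peval \<iota> (case_option (inverse (peval \<iota> p h)) p) (b i))"
    by (simp add: Q_def poly_0_coeff_0 ev0 X0)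
  have QT: "monom 1 s dvd ?ev Q (g j)" if "j < c" for j
  proof -
    have "psubst b (g j) \<in> ideal ?S" using iso that unfolding presentation_iso_def by blast
    from XI[OF this] show ?thesis unfolding peval_psubst[OF h] Q_def .
  qed
  have "\<exists>Q'. (\<forall>i. monom 1 s dvd Q' i - Q i) \<and> (\<forall>j<c. monom 1 (s + N) dvd ?ev Q' (g j))"
    by (rule hensel_lift[OF \<iota> s _ QT]) (rule jac, simp only: Q0)
  then obtain Q' where
    Q': "\<And>i. monom 1 s dvd Q' i - Q i" "\<And>j. j < c \<Longrightarrow> monom 1 (s + N) dvd ?ev Q' (g j)"
    by auto
  note QI = dvd_peval_ideal[OF h, where S = ?T and x = Q' and m = "monom 1 (s + N)"]
  define X' where "X' v = ?ev Q' (a v)" for v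
  have "monom 1 s dvd X' v - X v" for v
  proof -
    have "psubst b (a v) - pvar v \<in> ideal ?S" using iso unfolding presentation_iso_def by blast
    from XI[OF this] have "monom 1 s dvd ?ev Q (a v) - X v"
      by (simp add: unital_ring_hom_simps[OF unital_ring_hom_peval[OF h]] peval_psubst[OF h]
          peval_pvar[OF h] Q_def[abs_def])
    from dvd_add[OF peval_dvd_cong[where x = Q' and y = Q and p = "a v", OF h Q'(1)] this]
    show ?thesis by (simp add: X'_def)
  qed
  from this[of "Some _"] have 1: "monom 1 s dvd X' (Some v) - P v" for v by (simp add: X_def)
  have 2: "monom 1 (s + N) dvd ?ev (\<lambda>v. X' (Some v)) f" if "f \<in> J" for f
  proof -
    have "psubst a (emb f) \<in> ideal ?T" using iso that unfolding presentation_iso_def by blast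
    from QI[OF _ this] Q'(2) show ?thesis
      by (auto simp: peval_psubst[OF h] X'_def[symmetric] ev_emb)
  qed
  from 1 2 show ?thesis by (intro exI[of _ "\<lambda>v. X' (Some v)"]) blast
qed

section \<open>Evaluation in algebras over a quotient ring\<close>

text \<open>
  Vectors over the quotient ring \<open>R/(m)\<close> are represented by vectors over \<open>R\<close> up to this congruence.
  Laws over \<open>k[t]/(t\<^bsup>N+1\<^esup>)\<close> correspond to \<open>m = t\<^bsup>N+1\<^esup>\<close> and laws over \<open>k\<close> itself to \<open>m = 0\<close>.
\<close>

definition vcong :: "'r::comm_ring_1 \<Rightarrow> ('b \<Rightarrow> 'r) \<Rightarrow> ('b \<Rightarrow> 'r) \<Rightarrow> bool" where
  "vcong m x y \<longleftrightarrow> (\<forall>l. m dvd x l - y l)"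

lemma vcong_refl [simp]: "vcong m x x"
  by (simp add: vcong_def)

lemma vcong_sym: "vcong m x y \<Longrightarrow> vcong m y x"
  by (metis vcong_def dvd_minus_iff minus_diff_eq)

lemma vcong_trans [trans]:
  assumes "vcong m x y" "vcong m y z" shows "vcong m x z"
proof -
  have "x l - z l = (x l - y l) + (y l - z l)" for l by simp
  with assms show ?thesis unfolding vcong_def by (metis dvd_add)
qed

lemma vcong_add:
  assumes "vcong m x x'" "vcong m y y'" shows "vcong m (\<lambda>l. x l + y l) (\<lambda>l. x' l + y' l)"
  using assms unfolding vcong_def add_diff_add by (blast intro: dvd_add)

lemma vcong_scale: "vcong m x x' \<Longrightarrow> vcong m (\<lambda>l. a * x l) (\<lambda>l. a * x' l)"
  unfolding vcong_def right_diff_distrib[symmetric] by (blast intro: dvd_mult)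

lemma vcong_0_iff: "vcong m x (\<lambda>_. 0) \<longleftrightarrow> (\<forall>l. m dvd x l)"
  by (simp add: vcong_def)

lemma vcong_dvd_iff:
  assumes "vcong m x y" shows "m dvd x l \<longleftrightarrow> m dvd y l"
proof -
  have "m dvd x l - y l" using assms by (simp add: vcong_def)
  from dvd_add_right_iff[OF this, of "y l"] show ?thesis by simp
qed

lemma mult_dvd_cong:
  fixes a b :: "'r::comm_ring_1"
  assumes "m dvd a - a'" "m dvd b - b'" shows "m dvd a * b - a' * b'"
proof -
  have "a * b - a' * b' = (a - a') * b + a' * (b - b')" by (simp add: algebra_simps)
  with assms show ?thesis by (simp add: dvd_add)
qed

lemma mult_vcong:
  assumes "\<And>i j l. m dvd c i j l - c' i j l" "vcong m x x'" "vcong m y y'"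
  shows "vcong m (mult c x y) (mult c' x' y')"
  unfolding vcong_def mult_def sum_subtractf[symmetric]
  using assms by (auto simp: vcong_def intro!: dvd_sum mult_dvd_cong)

lemma mult_add_left: "mult c (\<lambda>l. x l + x' l) y = (\<lambda>l. mult c x y l + mult c x' y l)"
  by (simp add: mult_def fun_eq_iff distrib_right sum.distrib)

lemma mult_add_right: "mult c x (\<lambda>l. y l + y' l) = (\<lambda>l. mult c x y l + mult c x y' l)"
  by (simp add: mult_def fun_eq_iff distrib_right distrib_left sum.distrib)

lemma mult_scale_left: "mult c (\<lambda>l. a * x l) y = (\<lambda>l. a * mult c x y l)"
  by (simp add: mult_def fun_eq_iff sum_distrib_left mult.assoc)

lemma mult_scale_right: "mult c x (\<lambda>l. a * y l) = (\<lambda>l. a * mult c x y l)"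
  by (simp add: mult_def fun_eq_iff sum_distrib_left mult_ac)

lemma mult_vec_0_left: "mult c (\<lambda>l. 0) y = (\<lambda>l. 0)"
  by (simp add: mult_def)

lemma mult_vec_0_right: "mult c x (\<lambda>l. 0) = (\<lambda>l. 0)"
  by (simp add: mult_def)

lemma mult_sum_left: "mult c (\<lambda>l. \<Sum>k\<in>A. x k l) y = (\<lambda>l. \<Sum>k\<in>A. mult c (x k) y l)"
  by (induction A rule: infinite_finite_induct) (simp_all add: mult_vec_0_left mult_add_left)

lemma mult_sum_right: "mult c x (\<lambda>l. \<Sum>k\<in>A. y k l) = (\<lambda>l. \<Sum>k\<in>A. mult c x (y k) l)"
  by (induction A rule: infinite_finite_induct) (simp_all add: mult_vec_0_right mult_add_right)

lemma vec_basis_expansion: "(x :: 'b::finite \<Rightarrow> 'r::comm_ring_1) = (\<lambda>l. \<Sum>b\<in>UNIV. x b * basis_vec b l)"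
  by (simp add: basis_vec_def fun_eq_iff if_distrib cong: if_cong)

lemma mult_basis: "mult c (basis_vec i) (basis_vec j) = c i j"
proof
  fix l
  have "(\<Sum>j'\<in>UNIV. basis_vec i i' * basis_vec j j' * c i' j' l) = (if i' = i then c i j l else 0)" for i'
    by (cases "i' = i") (simp_all add: basis_vec_def if_distrib[of "\<lambda>x. x * _"] cong: if_cong)
  then show "mult c (basis_vec i) (basis_vec j) l = c i j l" by (simp add: mult_def)
qed

lemma mult_hom:
  assumes "unital_ring_hom h"
  shows "h (mult c x y l) = mult (\<lambda>i j l. h (c i j l)) (\<lambda>b. h (x b)) (\<lambda>b. h (y b)) l"
  by (simp add: mult_def unital_ring_hom_sum[OF assms] unital_ring_hom_simps[OF assms])

lemma bracket_eval_hom: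
  assumes "unital_ring_hom h"
  shows "h (bracket_eval c \<rho> t l) = bracket_eval (\<lambda>i j l. h (c i j l)) (\<lambda>v b. h (\<rho> v b)) t l"
  by (induction t arbitrary: l) (simp_all add: mult_hom[OF assms])

text \<open>
  The evaluation depends polynomially on the law, so it is natural in the coefficient ring.  All
  statements below about first and second differentials are obtained from this by applying
  substitutions of the deformation parameters.
\<close>

lemma free_eval_hom:
  assumes "unital_ring_hom h"
  shows "h (free_eval \<iota> u c br \<rho> f l) =
    free_eval (\<lambda>a. h (\<iota> a)) u (\<lambda>i j l. h (c i j l)) br (\<lambda>v b. h (\<rho> v b)) f l"
  by (simp add: free_eval_def unital_ring_hom_sum[OF assms] unital_ring_hom_simps[OF assms]
      bracket_eval_hom[OF assms] if_distrib[of h] cong: if_cong)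

lemma bracket_eval_vcong:
  assumes "\<And>i j l. m dvd c i j l - c' i j l" "\<And>v. v \<in> set (leaves t) \<Longrightarrow> vcong m (\<rho> v) (\<rho>' v)"
  shows "vcong m (bracket_eval c \<rho> t) (bracket_eval c' \<rho>' t)"
  using assms(2) by (induction t) (simp_all add: mult_vcong assms(1))

lemma free_eval_vcong:
  assumes "\<And>w. w \<in> Poly_Mapping.keys f \<Longrightarrow> letters w \<noteq> [] \<Longrightarrow>
    vcong m (bracket_eval c \<rho> (br w)) (bracket_eval c' \<rho>' (br' w))"
  shows "vcong m (free_eval \<iota> u c br \<rho> f) (free_eval \<iota> u c' br' \<rho>' f)"
  unfolding vcong_def free_eval_def sum_subtractf[symmetric]
  by (intro allI dvd_sum mult_dvd_cong) (use assms in \<open>auto simp: vcong_def\<close>)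

lemma free_eval_cong_law:
  assumes "\<And>i j l. m dvd c i j l - c' i j l" "\<And>v. vcong m (\<rho> v) (\<rho>' v)"
  shows "vcong m (free_eval \<iota> u c br \<rho> f) (free_eval \<iota> u c' br \<rho>' f)"
  by (intro free_eval_vcong bracket_eval_vcong assms)

definition word_value ::
  "('f \<Rightarrow> 'r::comm_ring_1) \<Rightarrow> ('b::finite \<Rightarrow> 'f) \<Rightarrow> ('b, 'r) law \<Rightarrow>
   ('x word \<Rightarrow> 'x bracketing) \<Rightarrow> ('x \<Rightarrow> 'b \<Rightarrow> 'r) \<Rightarrow> 'x word \<Rightarrow> 'b \<Rightarrow> 'r" where
  "word_value \<iota> u c br \<rho> w = (if letters w = [] then (\<lambda>l. \<iota> (u l)) else bracket_eval c \<rho> (br w))"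

lemma free_eval_word_value:
  "free_eval \<iota> u c br \<rho> f =
    (\<lambda>l. \<Sum>w\<in>Poly_Mapping.keys f. \<iota> (Poly_Mapping.lookup f w) * word_value \<iota> u c br \<rho> w l)"
  by (auto simp: free_eval_def word_value_def fun_eq_iff intro!: sum.cong)

lemma free_eval_0: "free_eval \<iota> u c br \<rho> 0 = (\<lambda>l. 0)"
  by (simp add: free_eval_def)

lemma free_eval_add:
  assumes "unital_ring_hom \<iota>"
  shows "free_eval \<iota> u c br \<rho> (f + g) = (\<lambda>l. free_eval \<iota> u c br \<rho> f l + free_eval \<iota> u c br \<rho> g l)"
  unfolding free_eval_word_value
  by (rule ext, rule keys_sum_add) (simp_all add: unital_ring_hom_simps[OF assms] distrib_right)

lemma free_eval_single:
  assumes "unital_ring_hom \<iota>"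
  shows "free_eval \<iota> u c br \<rho> (Poly_Mapping.single w a) = (\<lambda>l. \<iota> a * word_value \<iota> u c br \<rho> w l)"
  unfolding free_eval_word_value
  by (rule ext, rule keys_sum_single) (simp add: unital_ring_hom_simps[OF assms])

lemma letters_0: "letters 0 = []"
  by (simp add: zero_word_def)

lemma leaves_nonempty: "leaves t \<noteq> []"
  by (induction t) simp_all

lemma bracket_eval_irrelevant:
  "v \<notin> set (leaves t) \<Longrightarrow> bracket_eval c (\<rho>(v := x)) t = bracket_eval c \<rho> t"
  by (induction t) auto

text \<open>
  A variable that occurs once occurs in exactly one of the two subtrees of a node, and the product is
  linear in each factor.
\<close>

lemma bracket_eval_linear:
  assumes "v \<in> set (leaves t)" "distinct (leaves t)"
  shows "bracket_eval c (\<rho>(v := (\<lambda>l. \<Sum>b\<in>A. a b * e b l))) t =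
    (\<lambda>l. \<Sum>b\<in>A. a b * bracket_eval c (\<rho>(v := e b)) t l)"
  using assms
proof (induction t)
  case (Node s t)
  show ?case
  proof (cases "v \<in> set (leaves s)")
    case True
    with Node.prems have "v \<notin> set (leaves t)" by auto
    note t = bracket_eval_irrelevant[OF this]
    have "bracket_eval c (\<rho>(v := (\<lambda>l. \<Sum>b\<in>A. a b * e b l))) s =
        (\<lambda>l. \<Sum>b\<in>A. a b * bracket_eval c (\<rho>(v := e b)) s l)"
      by (rule Node.IH(1)[OF True]) (use Node.prems in simp)
    then show ?thesis by (simp only: bracket_eval.simps t mult_sum_left mult_scale_left)
  next
    case False
    with Node.prems have t: "v \<in> set (leaves t)" by auto
    note s = bracket_eval_irrelevant[OF False]
    have "bracket_eval c (\<rho>(v := (\<lambda>l. \<Sum>b\<in>A. a b * e b l))) t =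
        (\<lambda>l. \<Sum>b\<in>A. a b * bracket_eval c (\<rho>(v := e b)) t l)"
      by (rule Node.IH(2)[OF t]) (use Node.prems in simp)
    then show ?thesis by (simp only: bracket_eval.simps s mult_sum_right mult_scale_right)
  qed
qed simp

section \<open>Identities of a graded algebra\<close>

text \<open>
  The part of the notion of a graded algebra satisfying \<open>I\<close> over \<open>R/(m)\<close> that does not involve the
  identities in \<open>I\<close>.
\<close>

locale graded_law_mod =
  fixes \<iota> :: "'f::field \<Rightarrow> 'r::comm_ring_1" and m :: 'r
    and deg :: "'b::finite \<Rightarrow> 'g::group_add" and u :: "'b \<Rightarrow> 'f" and c :: "('b, 'r) law"
  assumes hom: "unital_ring_hom \<iota>" and unit_homogeneous: "homogeneous deg 0 u"
    and graded: "deg l \<noteq> deg i + deg j \<Longrightarrow> m dvd c i j l"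
    and assoc: "vcong m (mult c (mult c x y) z) (mult c x (mult c y z))"
    and unit_left: "vcong m (mult c (\<lambda>b. \<iota> (u b)) x) x"
    and unit_right: "vcong m (mult c x (\<lambda>b. \<iota> (u b))) x"
begin

lemma mult_cong: "vcong m x x' \<Longrightarrow> vcong m y y' \<Longrightarrow> vcong m (mult c x y) (mult c x' y')"
  by (rule mult_vcong) simp_all

lemma right_normed_append:
  assumes "xs \<noteq> []" "ys \<noteq> []"
  shows "vcong m (mult c (bracket_eval c \<rho> (right_normed xs)) (bracket_eval c \<rho> (right_normed ys)))
    (bracket_eval c \<rho> (right_normed (xs @ ys)))"
  using assms(1)
proof (induction xs rule: list_nonempty_induct)
  case (single x)
  with assms(2) show ?case by (cases ys) simp_all
next
  case (cons x xs)
  then have "right_normed (x # xs) = Node (Leaf x) (right_normed xs)"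
    "right_normed (x # xs @ ys) = Node (Leaf x) (right_normed (xs @ ys))"
    by (cases xs; simp)+
  then show ?case using vcong_trans[OF assoc mult_cong[OF vcong_refl cons.IH]] by simp
qed

text \<open>
  Generalized associativity: only the sequence of leaves matters.
\<close>

lemma bracket_eval_right_normed:
  "vcong m (bracket_eval c \<rho> t) (bracket_eval c \<rho> (right_normed (leaves t)))"
proof (induction t)
  case (Node s t)
  from vcong_trans[OF mult_cong[OF Node] right_normed_append] show ?case
    by (simp add: leaves_nonempty)
qed simp

abbreviation ev where "ev \<equiv> free_eval \<iota> u c std_br"
abbreviation wv where "wv \<equiv> word_value \<iota> u c std_br"

lemma free_eval_bracketing:
  assumes "\<And>w. w \<in> Poly_Mapping.keys f \<Longrightarrow> letters w \<noteq> [] \<Longrightarrow> leaves (br w) = letters w"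
  shows "vcong m (free_eval \<iota> u c br \<rho> f) (ev \<rho> f)"
  by (rule free_eval_vcong) (use assms bracket_eval_right_normed in metis)

lemma word_value_add: "vcong m (wv \<rho> (v + w)) (mult c (wv \<rho> v) (wv \<rho> w))"
proof (cases "letters v = [] \<or> letters w = []")
  case True
  then show ?thesis
  proof
    assume "letters v = []"
    then show ?thesis using vcong_sym[OF unit_left] by (simp add: word_value_def plus_word_def)
  next
    assume "letters w = []"
    then show ?thesis using vcong_sym[OF unit_right] by (simp add: word_value_def plus_word_def)
  qed
next
  case False
  then show ?thesis
    using vcong_sym[OF right_normed_append[of "letters v" "letters w" \<rho>]]
    by (simp add: word_value_def plus_word_def)
qed

text \<open>
  Together with additivity this says that evaluation is a ring homomorphism from the free algebra to
  the algebra over \<open>R/(m)\<close>.  It suffices to compare two monomials.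
\<close>

lemma ev_mult: "vcong m (ev \<rho> (f * g)) (mult c (ev \<rho> f) (ev \<rho> g))"
proof (induction f rule: poly_mapping_add_induct)
  case zero
  then show ?case by (simp add: free_eval_0 mult_vec_0_left)
next
  case (add f g)
  then show ?case by (simp add: distrib_right free_eval_add[OF hom] mult_add_left vcong_add)
next
  case (single v a)
  show ?case
  proof (induction g rule: poly_mapping_add_induct)
    case zero
    then show ?case by (simp add: free_eval_0 mult_vec_0_right)
  next
    case (add f g)
    then show ?case by (simp add: distrib_left free_eval_add[OF hom] mult_add_right vcong_add)
  next
    case (single w b)
    have "vcong m (\<lambda>l. \<iota> (a * b) * wv \<rho> (v + w) l) (\<lambda>l. \<iota> (a * b) * mult c (wv \<rho> v) (wv \<rho> w) l)"
      by (intro vcong_scale word_value_add)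
    then show ?case
      by (simp add: mult_single free_eval_single[OF hom] mult_scale_left mult_scale_right
          unital_ring_hom_simps[OF hom] mult_ac)
  qed
qed

text \<open>
  Homogeneity modulo \<open>m\<close>: as the law is graded only modulo \<open>m\<close>, products of homogeneous vectors have
  this weaker property.
\<close>

definition hom_mod :: "'g \<Rightarrow> ('b \<Rightarrow> 'r) \<Rightarrow> bool" where
  "hom_mod g x \<longleftrightarrow> (\<forall>b. deg b \<noteq> g \<longrightarrow> m dvd x b)"

lemma hom_mod_homogeneous: "homogeneous deg g x \<Longrightarrow> hom_mod g x"
  unfolding hom_mod_def homogeneous_def by (metis dvd_0_right)

lemma hom_mod_mult:
  assumes "hom_mod g x" "hom_mod h y" shows "hom_mod (g + h) (mult c x y)"
  unfolding hom_mod_def mult_def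
proof (intro allI impI dvd_sum)
  fix l i j assume l: "deg l \<noteq> g + h"
  show "m dvd x i * y j * c i j l"
  proof (cases "deg i = g \<and> deg j = h")
    case True with l show ?thesis by (intro dvd_mult graded) auto
  next
    case False with assms show ?thesis by (auto simp: hom_mod_def intro: dvd_mult2 dvd_mult)
  qed
qed

lemma hom_mod_word_value:
  assumes "\<And>v. homogeneous deg (snd v) (\<rho> v)"
  shows "hom_mod (word_degree w) (wv \<rho> w)"
proof (cases "letters w = []")
  case True
  have "homogeneous deg 0 (\<lambda>l. \<iota> (u l))"
    using unit_homogeneous unital_ring_hom_simps(1)[OF hom] unfolding homogeneous_def by metis
  with True show ?thesis
    by (simp add: word_value_def word_degree_def hom_mod_homogeneous)
next
  case False
  then have "hom_mod (sum_list (map snd (letters w))) (bracket_eval c \<rho> (right_normed (letters w)))"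
  proof (induction "letters w" arbitrary: w rule: list_nonempty_induct)
    case (single x)
    from single[symmetric] show ?case by (simp add: hom_mod_homogeneous assms)
  next
    case (cons x xs)
    from cons.hyps(2)[of "Word xs"]
    have "hom_mod (sum_list (map snd xs)) (bracket_eval c \<rho> (right_normed xs))" by simp
    from hom_mod_mult[OF hom_mod_homogeneous[OF assms[of x]] this] cons.hyps(1) show ?case
      unfolding cons.hyps(3)[symmetric] by (cases xs) simp_all
  qed
  with False show ?thesis by (simp add: word_value_def word_degree_def)
qed

lemma hom_mod_ev:
  assumes "\<And>v. homogeneous deg (snd v) (\<rho> v)" "f \<in> free_component g"
  shows "hom_mod g (ev \<rho> f)"
  unfolding hom_mod_def free_eval_word_value
proof (intro allI impI dvd_sum dvd_mult)
  fix b w assume "deg b \<noteq> g" "w \<in> Poly_Mapping.keys f"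
  with hom_mod_word_value[OF assms(1), of w] assms(2) show "m dvd wv \<rho> w b"
    by (auto simp: hom_mod_def free_component_def)
qed

lemma vcong_component: "hom_mod g x \<Longrightarrow> vcong m x (component deg g x)"
  by (auto simp: hom_mod_def vcong_def component_def)

lemma homogeneous_component: "homogeneous deg g (component deg g x)"
  by (auto simp: homogeneous_def component_def)

lemma ev_1: "ev \<rho> 1 = (\<lambda>l. \<iota> (u l))"
  unfolding single_one[symmetric] free_eval_single[OF hom]
  by (simp add: word_value_def letters_0 unital_ring_hom_simps[OF hom])

text \<open>
  Evaluating \<open>\<sigma> f\<close> at \<open>\<rho>\<close> is evaluating \<open>f\<close> at the images of the variables under \<open>\<sigma>\<close>, because both are
  homomorphisms that agree on variables.  These images are homogeneous modulo \<open>m\<close> only; passing to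
  their homogeneous components gives an honest graded assignment in the same congruence class.
\<close>

lemma ev_endomorphism:
  assumes \<sigma>: "graded_endomorphism \<sigma>" and \<rho>: "\<And>v. homogeneous deg (snd v) (\<rho> v)"
  defines "\<rho>' \<equiv> \<lambda>v. component deg (snd v) (ev \<rho> (\<sigma> (Poly_Mapping.single (Word [v]) 1)))"
  shows "vcong m (ev \<rho> (\<sigma> f)) (ev \<rho>' f)"
proof (induction f rule: poly_mapping_add_induct)
  have \<sigma>h: "unital_ring_hom \<sigma>" and \<sigma>c: "\<sigma> (free_const a) = free_const a"
    and \<sigma>g: "\<sigma> ` free_component g \<subseteq> free_component g" for a g
    using \<sigma> by (auto simp: graded_endomorphism_def)
  {
    case zero
    then show ?case by (simp add: unital_ring_hom_simps[OF \<sigma>h] free_eval_0)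
  next
    case (add f g)
    then show ?case by (simp add: unital_ring_hom_simps[OF \<sigma>h] free_eval_add[OF hom] vcong_add)
  next
    case (single w a)
    have var: "vcong m (ev \<rho> (\<sigma> (Poly_Mapping.single (Word [v]) 1))) (\<rho>' v)" for v
    proof -
      have "Poly_Mapping.single (Word [v]) 1 \<in> free_component (snd v)"
        by (simp add: free_component_def word_degree_def)
      with \<sigma>g have "\<sigma> (Poly_Mapping.single (Word [v]) 1) \<in> free_component (snd v)" by blast
      from vcong_component[OF hom_mod_ev[OF \<rho> this]] show ?thesis by (simp add: \<rho>'_def)
    qed
    have word: "vcong m (ev \<rho> (\<sigma> (Poly_Mapping.single (Word xs) 1))) (wv \<rho>' (Word xs))" for xs
    proof (induction xs)
      case Nil
      have "Poly_Mapping.single (Word []) 1 = (1 :: ('f, 'g) free_alg)" unfolding zero_word_def[symmetric] by simp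
      then show ?case by (simp only: unital_ring_hom_simps[OF \<sigma>h] ev_1) (simp add: word_value_def)
    next
      case (Cons x xs)
      have "Poly_Mapping.single (Word (x # xs)) (1::'f) =
          Poly_Mapping.single (Word [x]) 1 * Poly_Mapping.single (Word xs) 1"
        by (simp add: mult_single plus_word_def)
      then have "vcong m (ev \<rho> (\<sigma> (Poly_Mapping.single (Word (x # xs)) 1)))
        (mult c (ev \<rho> (\<sigma> (Poly_Mapping.single (Word [x]) 1))) (ev \<rho> (\<sigma> (Poly_Mapping.single (Word xs) 1))))"
        by (simp add: unital_ring_hom_simps[OF \<sigma>h] ev_mult)
      also have "vcong m \<dots> (mult c (\<rho>' x) (wv \<rho>' (Word xs)))"
        by (intro mult_cong var Cons)
      also have "vcong m \<dots> (wv \<rho>' (Word (x # xs)))"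
        using vcong_sym[OF word_value_add[of \<rho>' "Word [x]" "Word xs"]]
        by (simp add: word_value_def plus_word_def)
      finally show ?case .
    qed
    have "Poly_Mapping.single w a = free_const a * Poly_Mapping.single w 1"
      by (simp add: free_const_def mult_single)
    then have "vcong m (ev \<rho> (\<sigma> (Poly_Mapping.single w a)))
        (mult c (ev \<rho> (free_const a)) (ev \<rho> (\<sigma> (Poly_Mapping.single w 1))))"
      by (simp add: unital_ring_hom_simps[OF \<sigma>h] \<sigma>c ev_mult)
    also have "ev \<rho> (free_const a) = (\<lambda>l. \<iota> a * \<iota> (u l))"
      by (simp add: free_const_def free_eval_single[OF hom] word_value_def zero_word_def)
    also have "mult c \<dots> (ev \<rho> (\<sigma> (Poly_Mapping.single w 1))) =
        (\<lambda>l. \<iota> a * mult c (\<lambda>l. \<iota> (u l)) (ev \<rho> (\<sigma> (Poly_Mapping.single w 1))) l)"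
      by (rule mult_scale_left)
    also have "vcong m \<dots> (\<lambda>l. \<iota> a * wv \<rho>' w l)"
      using word[of "letters w"] by (intro vcong_scale vcong_trans[OF unit_left]) simp
    also have "\<dots> = ev \<rho>' (Poly_Mapping.single w a)"
      by (simp add: free_eval_single[OF hom])
    finally show ?case .
  }
qed

definition satisfied :: "('f, 'g) free_alg set" where
  "satisfied = {f. \<forall>\<rho>. (\<forall>v. homogeneous deg (snd v) (\<rho> v)) \<longrightarrow> (\<forall>l. m dvd ev \<rho> f l)}"

lemma satisfiedD:
  assumes "f \<in> satisfied" "\<And>v. homogeneous deg (snd v) (\<rho> v)"
  shows "m dvd ev \<rho> f l"
  using assms unfolding satisfied_def by blast

text \<open>
  Stability under graded endomorphisms is \<open>ev_endomorphism\<close>, and the ideal property holds because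
  evaluation is multiplicative.  Hence an algebra satisfies \<open>I\<close> as soon as it satisfies generators of \<open>I\<close>.
\<close>

lemma graded_T_ideal_satisfied: "graded_T_ideal satisfied"
  unfolding graded_T_ideal_def
proof (intro conjI ballI allI impI)
  show "0 \<in> satisfied" by (simp add: satisfied_def free_eval_0)
next
  fix p q assume "p \<in> satisfied" "q \<in> satisfied"
  then show "p + q \<in> satisfied" by (simp add: satisfied_def free_eval_add[OF hom] dvd_add)
next
  fix p a assume p: "p \<in> satisfied"
  have 0: "vcong m (ev \<rho> p) (\<lambda>l. 0)" if "\<forall>v. homogeneous deg (snd v) (\<rho> v)" for \<rho>
    using p that by (simp add: satisfied_def vcong_0_iff)
  have "vcong m (ev \<rho> (a * p)) (\<lambda>l. 0)" if "\<forall>v. homogeneous deg (snd v) (\<rho> v)" for \<rho>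
    using vcong_trans[OF ev_mult mult_cong[OF vcong_refl 0[OF that]]] by (simp add: mult_vec_0_right)
  then show "a * p \<in> satisfied" by (simp add: satisfied_def vcong_0_iff)
  have "vcong m (ev \<rho> (p * a)) (\<lambda>l. 0)" if "\<forall>v. homogeneous deg (snd v) (\<rho> v)" for \<rho>
    using vcong_trans[OF ev_mult mult_cong[OF 0[OF that] vcong_refl]] by (simp add: mult_vec_0_left)
  then show "p * a \<in> satisfied" by (simp add: satisfied_def vcong_0_iff)
next
  fix \<sigma> :: "('f, 'g) free_alg \<Rightarrow> ('f, 'g) free_alg"
  assume \<sigma>: "graded_endomorphism \<sigma>"
  show "\<sigma> ` satisfied \<subseteq> satisfied"
  proof safe
    fix f assume f: "f \<in> satisfied"
    show "\<sigma> f \<in> satisfied"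
      unfolding satisfied_def
    proof safe
      fix \<rho> :: "'g gvar \<Rightarrow> 'b \<Rightarrow> 'r" and l
      assume "\<forall>v. homogeneous deg (snd v) (\<rho> v)"
      then have \<rho>: "homogeneous deg (snd v) (\<rho> v)" for v by blast
      show "m dvd ev \<rho> (\<sigma> f) l"
        unfolding vcong_dvd_iff[OF ev_endomorphism[OF \<sigma> \<rho>]]
        by (rule satisfiedD[OF f homogeneous_component])
    qed
  qed
qed

text \<open>
  A multilinear polynomial is determined by its values on basis vectors.  The arguments are expanded
  one variable at a time: \<open>S\<close> is the set of the variables that are not yet known to be assigned a basis
  vector.
\<close>

lemma multilinear_satisfied:
  assumes f: "multilinear_generator f"
    and basis: "\<And>bs l. map deg bs = map snd (gen_vars f) \<Longrightarrow>
      m dvd free_eval \<iota> u c (gen_br f) (assign deg (gen_vars f) (map basis_vec bs)) (gen_poly f) l"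
  shows "gen_poly f \<in> satisfied"
proof -
  let ?E = "\<lambda>\<rho>. free_eval \<iota> u c (gen_br f) \<rho> (gen_poly f)"
  have lv: "leaves (gen_br f w) = letters w" "set (letters w) = set (gen_vars f)" "distinct (letters w)"
    if "w \<in> Poly_Mapping.keys (gen_poly f)" "letters w \<noteq> []" for w
    using f that unfolding multilinear_generator_def
    by (metis mset_eq_setD mset_eq_imp_distinct_iff)+
  have empty: "gen_vars f = []" if "w \<in> Poly_Mapping.keys (gen_poly f)" "letters w = []" for w
    using f that unfolding multilinear_generator_def by force
  have lin: "?E (\<rho>(v := (\<lambda>l. \<Sum>b\<in>A. a b * e b l))) l = (\<Sum>b\<in>A. a b * ?E (\<rho>(v := e b)) l)"
    if "v \<in> set (gen_vars f)" for v \<rho> l A a and e :: "'b \<Rightarrow> 'b \<Rightarrow> 'r"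
  proof -
    have ne: "letters w \<noteq> []" if "w \<in> Poly_Mapping.keys (gen_poly f)" for w
      using empty[OF that] \<open>v \<in> set (gen_vars f)\<close> by auto
    have "?E (\<rho>(v := (\<lambda>l. \<Sum>b\<in>A. a b * e b l))) l =
      (\<Sum>w\<in>Poly_Mapping.keys (gen_poly f). \<Sum>b\<in>A. a b *
        (\<iota> (Poly_Mapping.lookup (gen_poly f) w) * bracket_eval c (\<rho>(v := e b)) (gen_br f w) l))"
      unfolding free_eval_def
      by (rule sum.cong) (simp_all add: ne bracket_eval_linear lv that sum_distrib_left mult_ac)
    also have "\<dots> = (\<Sum>b\<in>A. a b * ?E (\<rho>(v := e b)) l)"
      unfolding free_eval_def by (subst sum.swap) (simp add: ne sum_distrib_left)
    finally show ?thesis .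
  qed
  have *: "m dvd ?E \<rho> l"
    if "finite S" "S \<subseteq> set (gen_vars f)" "\<And>v. homogeneous deg (snd v) (\<rho> v)"
      "\<And>v. v \<in> set (gen_vars f) - S \<Longrightarrow> \<exists>b. deg b = snd v \<and> \<rho> v = basis_vec b" for S \<rho> l
    using that
  proof (induction S arbitrary: \<rho> rule: finite_induct)
    case empty
    then have "\<forall>v. \<exists>b. v \<in> set (gen_vars f) \<longrightarrow> deg b = snd v \<and> \<rho> v = basis_vec b" by blast
    then obtain b where b: "\<And>v. v \<in> set (gen_vars f) \<Longrightarrow> deg (b v) = snd v \<and> \<rho> v = basis_vec (b v)"
      by metis
    have "assign deg (gen_vars f) (map basis_vec (map b (gen_vars f))) v = \<rho> v" if "v \<in> set (gen_vars f)" for v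
    proof -
      have "map_of (zip (gen_vars f) (map (\<lambda>v. basis_vec (b v) :: 'b \<Rightarrow> 'r) (gen_vars f))) v = Some (basis_vec (b v))"
        using that by (simp add: map_of_zip_map)
      with b[OF that] show ?thesis
        by (auto simp: assign_def o_def component_def basis_vec_def fun_eq_iff)
    qed
    then have cong: "vcong m (?E \<rho>) (?E (assign deg (gen_vars f) (map basis_vec (map b (gen_vars f)))))"
      by (intro free_eval_vcong bracket_eval_vcong) (simp_all add: lv)
    have "map deg (map b (gen_vars f)) = map snd (gen_vars f)" using b by simp
    then show ?case unfolding vcong_dvd_iff[OF cong] by (rule basis)
  next
    case (insert v S)
    \<comment> \<open>basis vectors of other degrees are left out, so that the assignment stays graded\<close>
    have e: "\<rho> v = (\<lambda>l. \<Sum>b | deg b = snd v. \<rho> v b * basis_vec b l)"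
    proof -
      have "\<rho> v = (\<lambda>l. \<Sum>b\<in>UNIV. \<rho> v b * basis_vec b l)" by (rule vec_basis_expansion)
      also have "\<dots> = (\<lambda>l. \<Sum>b | deg b = snd v. \<rho> v b * basis_vec b l)"
      proof -
        have "\<rho> v b = 0" if "deg b \<noteq> snd v" for b
          using insert.prems(2)[of v] that unfolding homogeneous_def by blast
        then show ?thesis by (intro ext sum.mono_neutral_right) auto
      qed
      finally show ?thesis .
    qed
    have "?E \<rho> l = ?E (\<rho>(v := (\<lambda>l. \<Sum>b | deg b = snd v. \<rho> v b * basis_vec b l))) l"
      by (simp flip: e)
    also have "\<dots> = (\<Sum>b | deg b = snd v. \<rho> v b * ?E (\<rho>(v := basis_vec b)) l)"
      using insert.prems(1) by (intro lin) simp
    also have "m dvd \<dots>"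
    proof (intro dvd_sum dvd_mult insert.IH)
      fix b w assume b: "b \<in> {b. deg b = snd v}"
      show "homogeneous deg (snd w) ((\<rho>(v := basis_vec b)) w)"
        using b insert.prems(2) by (auto simp: homogeneous_def basis_vec_def)
      show "\<exists>b'. deg b' = snd w \<and> (\<rho>(v := basis_vec b)) w = basis_vec b'" if "w \<in> set (gen_vars f) - S"
        using that b insert.prems(3)[of w] by (cases "w = v") auto
    qed (use insert.prems in auto)
    finally show ?case .
  qed
  have "m dvd ?E \<rho> l" if "\<forall>v. homogeneous deg (snd v) (\<rho> v)" for \<rho> l
    by (rule *[of "set (gen_vars f)"]) (use that in auto)
  moreover have "vcong m (?E \<rho>) (ev \<rho> (gen_poly f))" for \<rho>
    by (rule free_eval_bracketing) (rule lv)
  note vcong_dvd_iff[OF this]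
  ultimately have "m dvd ev \<rho> (gen_poly f) l" if "\<forall>v. homogeneous deg (snd v) (\<rho> v)" for \<rho> l
    using that by blast
  then show ?thesis unfolding satisfied_def by blast
qed

end

section \<open>Laws as points of the scheme of algebra structures\<close>

lemma vcong_sum:
  assumes "\<And>k. k \<in> A \<Longrightarrow> vcong m (x k) (y k)"
  shows "vcong m (\<lambda>l. \<Sum>k\<in>A. x k l) (\<lambda>l. \<Sum>k\<in>A. y k l)"
  unfolding vcong_def sum_subtractf[symmetric] using assms by (auto simp: vcong_def intro!: dvd_sum)

lemma mult_expand_left: "mult c x y = (\<lambda>l. \<Sum>b\<in>UNIV. x b * mult c (basis_vec b) y l)"
  by (subst vec_basis_expansion[of x]) (simp only: mult_sum_left mult_scale_left)

lemma mult_expand_right: "mult c x y = (\<lambda>l. \<Sum>b\<in>UNIV. y b * mult c x (basis_vec b) l)"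
  by (subst vec_basis_expansion[of y]) (simp only: mult_sum_right mult_scale_right)

text \<open>
  Associativity and the unit laws are multilinear, so they extend from basis vectors.
\<close>

lemma graded_law_mod_basisI:
  fixes c :: "('b::finite, 'r::comm_ring_1) law" and deg :: "'b \<Rightarrow> 'g::group_add"
  assumes "unital_ring_hom \<iota>" "homogeneous deg 0 u"
    and "\<And>i j l. deg l \<noteq> deg i + deg j \<Longrightarrow> m dvd c i j l"
    and assoc: "\<And>i j k. vcong m (mult c (mult c (basis_vec i) (basis_vec j)) (basis_vec k))
        (mult c (basis_vec i) (mult c (basis_vec j) (basis_vec k)))"
    and unit_left: "\<And>i. vcong m (mult c (\<lambda>b. \<iota> (u b)) (basis_vec i)) (basis_vec i)"
    and unit_right: "\<And>i. vcong m (mult c (basis_vec i) (\<lambda>b. \<iota> (u b))) (basis_vec i)"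
  shows "graded_law_mod \<iota> m deg u c"
proof
  fix x y z :: "'b \<Rightarrow> 'r"
  have "vcong m (mult c (mult c (basis_vec i) (basis_vec j)) z) (mult c (basis_vec i) (mult c (basis_vec j) z))" for i j
    unfolding mult_expand_right[of c _ z] mult_sum_right mult_scale_right
    by (intro vcong_sum vcong_scale assoc)
  then have "vcong m (mult c (mult c (basis_vec i) y) z) (mult c (basis_vec i) (mult c y z))" for i
    unfolding mult_expand_right[of c _ y] mult_expand_left[of c y] mult_sum_right mult_scale_right
      mult_sum_left mult_scale_left
    by (intro vcong_sum vcong_scale)
  then show "vcong m (mult c (mult c x y) z) (mult c x (mult c y z))"
    unfolding mult_expand_left[of c x] mult_sum_left mult_scale_left
    by (intro vcong_sum vcong_scale)
  show "vcong m (mult c (\<lambda>b. \<iota> (u b)) x) x"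
    by (subst mult_expand_right, subst (2) vec_basis_expansion, intro vcong_sum vcong_scale unit_left)
  show "vcong m (mult c x (\<lambda>b. \<iota> (u b))) x"
    by (subst mult_expand_left, subst (2) vec_basis_expansion, intro vcong_sum vcong_scale unit_right)
qed (use assms in auto)

lemma graded_I_law_iff:
  assumes "unital_ring_hom \<iota>" "homogeneous deg 0 u"
  shows "graded_I_law \<iota> m deg u I c \<longleftrightarrow>
    graded_law_mod \<iota> m deg u c \<and> I \<subseteq> graded_law_mod.satisfied \<iota> m deg u c"
proof -
  have "graded_law_mod \<iota> m deg u c \<longleftrightarrow>
     (\<forall>i j l. deg l \<noteq> deg i + deg j \<longrightarrow> m dvd c i j l) \<and>
     (\<forall>x y z l. m dvd (mult c (mult c x y) z l - mult c x (mult c y z) l)) \<and>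
     (\<forall>x l. m dvd (mult c (\<lambda>b. \<iota> (u b)) x l - x l) \<and>
            m dvd (mult c x (\<lambda>b. \<iota> (u b)) l - x l))"
    unfolding graded_law_mod_def vcong_def using assms by blast
  moreover have "I \<subseteq> graded_law_mod.satisfied \<iota> m deg u c \<longleftrightarrow>
     (\<forall>f\<in>I. \<forall>\<rho>. (\<forall>v. homogeneous deg (snd v) (\<rho> v)) \<longrightarrow>
        (\<forall>l. m dvd free_eval \<iota> u c std_br \<rho> f l))" if "graded_law_mod \<iota> m deg u c"
    unfolding graded_law_mod.satisfied_def[OF that] by blast
  ultimately show ?thesis unfolding graded_I_law_def by blast
qed

lemma (in graded_law_mod) T_ideal_generated_satisfied:
  "T_ideal_generated S \<subseteq> satisfied \<longleftrightarrow> S \<subseteq> satisfied"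
  using graded_T_ideal_satisfied unfolding T_ideal_generated_def by blast

lemma homogeneous_assign: "homogeneous deg (snd v) (assign deg vs xs v)"
  by (auto simp: assign_def homogeneous_def component_def split: option.split)

lemma (in graded_law_mod) satisfied_generator:
  assumes "multilinear_generator f" "gen_poly f \<in> satisfied" "\<And>v. homogeneous deg (snd v) (\<rho> v)"
  shows "m dvd free_eval \<iota> u c (gen_br f) \<rho> (gen_poly f) l"
proof -
  have "vcong m (free_eval \<iota> u c (gen_br f) \<rho> (gen_poly f)) (ev \<rho> (gen_poly f))"
    using assms(1) by (intro free_eval_bracketing) (auto simp: multilinear_generator_def)
  from vcong_dvd_iff[OF this] satisfiedD[OF assms(2,3)] show ?thesis by blast
qed

lemma hom_basis_vec:
  assumes "unital_ring_hom h" shows "h (basis_vec b l) = basis_vec b l"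
  by (simp add: basis_vec_def unital_ring_hom_simps[OF assms])

lemma hom_assign:
  assumes "unital_ring_hom h"
  shows "h (assign deg vs xs v b) = assign deg vs (map (\<lambda>x b. h (x b)) xs) v b"
proof -
  have "map_of (zip vs (map (\<lambda>x b. h (x b)) xs)) v = map_option (\<lambda>x b. h (x b)) (map_of (zip vs xs) v)"
    by (simp add: zip_map2 map_of_map)
  then show ?thesis
    by (simp add: assign_def component_def unital_ring_hom_simps[OF assms] split: option.split)
qed

text \<open>
  The \<open>R/(m)\<close>-points of the scheme of algebra structures are the graded unital associative laws over
  \<open>R/(m)\<close> that satisfy \<open>I\<close>.  Evaluating the generic law at \<open>c\<close> turns each equation into the corresponding
  condition on \<open>c\<close> at basis vectors; multilinearity extends the conditions to all vectors, and the
  T-ideal property extends them from the generators to \<open>I\<close>.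
\<close>

lemma alg_equations_vanish_iff:
  fixes c :: "('b::finite, 'r::comm_ring_1) law" and fs :: "('f::field, 'g::group_add) mgen list"
  assumes \<iota>: "unital_ring_hom \<iota>" and u: "homogeneous deg 0 u"
    and fs: "\<And>f. f \<in> set fs \<Longrightarrow> multilinear_generator f"
  shows "(\<forall>p\<in>alg_equations deg u fs. m dvd peval \<iota> (law_point c) p) \<longleftrightarrow>
    graded_I_law \<iota> m deg u (T_ideal_generated (gen_poly ` set fs)) c" (is "?V \<longleftrightarrow> ?L")
proof -
  \<comment> \<open>specialization of the generic law to \<open>c\<close>\<close>
  define H where "H = peval \<iota> (law_point c)"
  have H: "unital_ring_hom H" unfolding H_def by (rule unital_ring_hom_peval[OF \<iota>])
  note Hs = unital_ring_hom_simps[OF H]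
  have Hlaw: "H (generic_law i j l) = c i j l" for i j l
    by (simp add: H_def generic_law_def peval_pvar[OF \<iota>] law_point_def)
  have Hconst: "H (pconst a) = \<iota> a" for a by (simp add: H_def peval_pconst[OF \<iota>])
  have Hmult: "H (mult generic_law x y l) = mult c (\<lambda>b. H (x b)) (\<lambda>b. H (y b)) l" for x y l
    by (subst mult_hom[OF H]) (simp add: Hlaw)
  have Hbasis: "(\<lambda>l. H (basis_vec b l)) = basis_vec b" for b
    by (simp add: hom_basis_vec[OF H])
  have Hgen: "H (free_eval pconst u generic_law br (assign deg vs (map basis_vec bs)) f l) =
      free_eval \<iota> u c br (assign deg vs (map basis_vec bs)) f l" for br vs bs f l
    by (subst free_eval_hom[OF H]) (simp add: Hlaw Hconst hom_assign[OF H] o_def Hbasis)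
  have ball2: "(\<forall>p\<in>{t i j | i j. P i j}. Q p) \<longleftrightarrow> (\<forall>i j. P i j \<longrightarrow> Q (t i j))"
    for t :: "'x \<Rightarrow> 'y \<Rightarrow> 'z" and P Q by blast
  have ball3: "(\<forall>p\<in>{t i j k | i j k. P i j k}. Q p) \<longleftrightarrow> (\<forall>i j k. P i j k \<longrightarrow> Q (t i j k))"
    for t :: "'w \<Rightarrow> 'x \<Rightarrow> 'y \<Rightarrow> 'z" and P Q by blast
  have ball4: "(\<forall>p\<in>{t i j k l | i j k l. P i j k l}. Q p) \<longleftrightarrow> (\<forall>i j k l. P i j k l \<longrightarrow> Q (t i j k l))"
    for t :: "'v \<Rightarrow> 'w \<Rightarrow> 'x \<Rightarrow> 'y \<Rightarrow> 'z" and P Q by blast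
  have V: "?V \<longleftrightarrow>
    (\<forall>i j l. deg l \<noteq> deg i + deg j \<longrightarrow> m dvd c i j l) \<and>
    (\<forall>i j k l. m dvd mult c (mult c (basis_vec i) (basis_vec j)) (basis_vec k) l
        - mult c (basis_vec i) (mult c (basis_vec j) (basis_vec k)) l) \<and>
    (\<forall>i l. m dvd mult c (\<lambda>b. \<iota> (u b)) (basis_vec i) l - basis_vec i l) \<and>
    (\<forall>i l. m dvd mult c (basis_vec i) (\<lambda>b. \<iota> (u b)) l - basis_vec i l) \<and>
    (\<forall>f bs l. f \<in> set fs \<and> map deg bs = map snd (gen_vars f) \<longrightarrow>
       m dvd free_eval \<iota> u c (gen_br f) (assign deg (gen_vars f) (map basis_vec bs)) (gen_poly f) l)"
    unfolding alg_equations_def Let_def H_def[symmetric] ball_Un ball2 ball3 ball4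
    by (simp add: Hs Hmult Hlaw Hconst Hbasis Hgen hom_basis_vec[OF H] conj_ac)
  show ?thesis
  proof
    assume ?V
    note v = this[unfolded V]
    interpret graded_law_mod \<iota> m deg u c
      by (rule graded_law_mod_basisI[OF \<iota> u]) (use v in \<open>auto simp: vcong_def\<close>)
    have "gen_poly ` set fs \<subseteq> satisfied"
      using v fs by (auto intro!: multilinear_satisfied)
    then show ?L
      unfolding graded_I_law_iff[OF \<iota> u] T_ideal_generated_satisfied using graded_law_mod_axioms by blast
  next
    assume L: ?L
    then interpret graded_law_mod \<iota> m deg u c unfolding graded_I_law_iff[OF \<iota> u] by blast
    from L have "gen_poly ` set fs \<subseteq> satisfied"
      unfolding graded_I_law_iff[OF \<iota> u] T_ideal_generated_satisfied by blast
    then show ?V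
      unfolding V using assoc unit_left unit_right
      by (auto simp: graded fs vcong_def intro!: satisfied_generator homogeneous_assign)
  qed
qed

text \<open>
  A first-order deformation is a \<open>k[t]/(t\<^sup>2)\<close>-point of the scheme through \<open>\<mu>\<close>, to which infinitesimal
  lifting applies.
\<close>

lemma first_order_deformation_lifts:
  fixes \<iota> :: "'f::field \<Rightarrow> 'k::field" and \<mu> :: "('b::finite, 'k) law"
    and deg :: "'b \<Rightarrow> 'g::group_add" and fs :: "('f, 'g) mgen list"
  assumes \<iota>: "unital_ring_hom \<iota>" and u: "homogeneous deg 0 u"
    and fs: "\<And>f. f \<in> set fs \<Longrightarrow> multilinear_generator f"
    and I: "I = T_ideal_generated (gen_poly ` set fs)"
    and smooth: "smooth_at \<iota> (alg_ideal deg u fs) (law_point \<mu>)"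
    and M: "I_deformation \<iota> deg u I \<mu> 1 M" and N: "1 \<le> N"
  shows "\<exists>M'. I_deformation \<iota> deg u I \<mu> N M' \<and> law_cong 2 M' M"
proof -
  note h = unital_ring_hom_const_poly_comp[OF \<iota>]
  have vanish: "(\<forall>p\<in>alg_equations deg u fs. m dvd peval (\<lambda>c. [:\<iota> c:]) (law_point c) p) \<longleftrightarrow>
    graded_I_law (\<lambda>c. [:\<iota> c:]) m deg u I c" for m c
    unfolding I by (rule alg_equations_vanish_iff[OF h u]) (rule fs)
  have M1: "law_cong 1 M (\<lambda>i j l. [:\<mu> i j l:])" using M by (simp add: I_deformation_def)
  have eqs: "\<forall>p\<in>alg_equations deg u fs. monom 1 2 dvd peval (\<lambda>c. [:\<iota> c:]) (law_point M) p"
    using M unfolding vanish I_deformation_def one_add_one by blast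
  have J: "monom 1 2 dvd peval (\<lambda>c. [:\<iota> c:]) (law_point M) p" if "p \<in> alg_ideal deg u fs" for p
    by (rule dvd_peval_ideal[OF h, where S = "alg_equations deg u fs"])
      (use eqs that in \<open>simp_all only: alg_ideal_def\<close>)
  have M0: "coeff (law_point M v) 0 = law_point \<mu> v" for v
    using M1 by (cases v) (auto simp: law_point_def law_cong_def monom_1_dvd_iff')
  have "2 + (N - 1) = N + 1" using N by simp
  with smooth_at_lift[OF \<iota> smooth _ M0 J, of "N - 1"] obtain P where
    P: "\<And>v. monom 1 2 dvd P v - law_point M v"
    "\<And>f. f \<in> alg_ideal deg u fs \<Longrightarrow> monom 1 (N + 1) dvd peval (\<lambda>c. [:\<iota> c:]) P f"
    by (metis one_le_numeral)
  define M' where "M' i j l = P (i, j, l)" for i j l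
  have M': "law_point M' = P" by (auto simp: law_point_def M'_def)
  have "graded_I_law (\<lambda>c. [:\<iota> c:]) (monom 1 (N + 1)) deg u I M'"
    unfolding vanish[symmetric] M' using P(2) by (auto simp: alg_ideal_def in_ideal)
  moreover have c2: "law_cong 2 M' M"
    using P(1) unfolding law_cong_def M'_def law_point_def by fastforce
  moreover have "law_cong 1 M' (\<lambda>i j l. [:\<mu> i j l:])"
    using c2 M1 by (simp add: law_cong_def monom_1_dvd_iff')
  ultimately show ?thesis unfolding I_deformation_def by blast
qed

section \<open>Differentials of evaluations\<close>

lemma unital_ring_hom_map_poly:
  fixes h :: "'a::comm_ring_1 \<Rightarrow> 'b::comm_ring_1"
  assumes "unital_ring_hom h" shows "unital_ring_hom (map_poly h)"
  unfolding unital_ring_hom_def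
  by (auto simp: poly_eq_iff coeff_map_poly coeff_mult unital_ring_hom_simps[OF assms]
      unital_ring_hom_sum[OF assms] one_pCons coeff_pCons split: nat.split)

lemma poly_pderiv_0: "poly (pderiv p) 0 = coeff p 1"
  by (simp add: poly_0_coeff_0 coeff_pderiv)

lemma D1_coeff:
  "D1 \<iota> u br \<rho> f \<mu> \<phi> l =
    coeff (free_eval (\<lambda>c. [:\<iota> c:]) u (\<lambda>i j l. [:\<mu> i j l, \<phi> i j l:]) br (\<lambda>v b. [:\<rho> v b:]) f l) 1"
  by (simp add: D1_def poly_pderiv_0)

text \<open>
  The value at the law \<open>\<mu> + t \<phi> + s \<psi>\<close>, as a polynomial in \<open>s\<close> (the outer variable) over \<open>k[t]\<close>.
\<close>

definition two_param ::
  "('f::field \<Rightarrow> 'r::idom) \<Rightarrow> ('b::finite \<Rightarrow> 'f) \<Rightarrow> ('g gvar word \<Rightarrow> 'g gvar bracketing) \<Rightarrow>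
   ('g gvar \<Rightarrow> 'b \<Rightarrow> 'r) \<Rightarrow> ('f, 'g) free_alg \<Rightarrow>
   ('b, 'r) law \<Rightarrow> ('b, 'r) law \<Rightarrow> ('b, 'r) law \<Rightarrow> 'b \<Rightarrow> 'r poly poly" where
  "two_param \<iota> u br \<rho> f \<mu> \<phi> \<psi> =
    free_eval (\<lambda>c. [:[:\<iota> c:]:]) u (\<lambda>i j l. [:[:\<mu> i j l, \<phi> i j l:], [:\<psi> i j l:]:]) br (\<lambda>v b. [:[:\<rho> v b:]:]) f"

text \<open>
  The substitution \<open>s = r t\<close>: besides the terms without \<open>s\<close>, only the coefficient of \<open>s\<^sup>1 t\<^sup>0\<close> contributes
  to degree one.  The next lemma is the analogue for \<open>s = r t\<^sup>2\<close> and degree two.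
\<close>

lemma coeff_poly_monom_1:
  fixes p :: "'k::idom poly poly"
  shows "coeff (poly p (monom r 1)) 1 = coeff (coeff p 0) 1 + r * coeff (coeff p 1) 0"
proof -
  obtain a q where p: "p = pCons a q" by (cases p)
  obtain b s where q: "q = pCons b s" by (cases q)
  show ?thesis by (simp add: p q coeff_monom_mult coeff_pCons)
qed

lemma coeff_poly_monom_2:
  fixes p :: "'k::idom poly poly"
  shows "coeff (poly p (monom r 2)) 2 = coeff (coeff p 0) 2 + r * coeff (coeff p 1) 0"
proof -
  obtain a q where p: "p = pCons a q" by (cases p)
  obtain b s where q: "q = pCons b s" by (cases q)
  show ?thesis by (simp add: p q coeff_monom_mult coeff_pCons)
qed

lemma two_param_subst:
  "poly (two_param \<iota> u br \<rho> f \<mu> \<phi> \<psi> l) x =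
    free_eval (\<lambda>c. [:\<iota> c:]) u (\<lambda>i j l. [:\<mu> i j l, \<phi> i j l:] + x * [:\<psi> i j l:]) br (\<lambda>v b. [:\<rho> v b:]) f l"
  unfolding two_param_def by (subst free_eval_hom[OF unital_ring_hom_poly]) simp

lemma two_param_coeff_0:
  "coeff (two_param \<iota> u br \<rho> f \<mu> \<phi> \<psi> l) 0 =
    free_eval (\<lambda>c. [:\<iota> c:]) u (\<lambda>i j l. [:\<mu> i j l, \<phi> i j l:]) br (\<lambda>v b. [:\<rho> v b:]) f l"
  unfolding poly_0_coeff_0[symmetric] two_param_subst by simp

text \<open>
  Setting \<open>t = 0\<close> leaves the value at \<open>\<mu> + s \<psi>\<close>.
\<close>

lemma two_param_coeff_1:
  "coeff (coeff (two_param \<iota> u br \<rho> f \<mu> \<phi> \<psi> l) 1) 0 = D1 \<iota> u br \<rho> f \<mu> \<psi> l"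
proof -
  have h: "unital_ring_hom (map_poly (\<lambda>p. poly p 0))"
    by (intro unital_ring_hom_map_poly unital_ring_hom_poly)
  have "coeff (coeff (two_param \<iota> u br \<rho> f \<mu> \<phi> \<psi> l) 1) 0 =
      coeff (map_poly (\<lambda>p. poly p 0) (two_param \<iota> u br \<rho> f \<mu> \<phi> \<psi> l)) 1"
    by (simp add: coeff_map_poly poly_0_coeff_0)
  also have "\<dots> = D1 \<iota> u br \<rho> f \<mu> \<psi> l"
    unfolding two_param_def D1_coeff by (subst free_eval_hom[OF h]) (simp add: map_poly_pCons)
  finally show ?thesis .
qed

lemma D1_affine:
  "D1 \<iota> u br \<rho> f \<mu> (\<lambda>i j l. \<phi> i j l + r * \<psi> i j l) l =
    D1 \<iota> u br \<rho> f \<mu> \<phi> l + r * D1 \<iota> u br \<rho> f \<mu> \<psi> l"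
proof -
  let ?G = "two_param \<iota> u br \<rho> f \<mu> \<phi> \<psi> l"
  have "poly ?G (monom r 1) =
      free_eval (\<lambda>c. [:\<iota> c:]) u (\<lambda>i j l. [:\<mu> i j l, \<phi> i j l + r * \<psi> i j l:]) br (\<lambda>v b. [:\<rho> v b:]) f l"
    by (simp add: two_param_subst monom_Suc monom_0 mult.commute)
  with coeff_poly_monom_1[of ?G r] two_param_coeff_1[of \<iota> u br \<rho> f \<mu> \<phi> \<psi> l] show ?thesis
    by (simp add: D1_coeff two_param_coeff_0)
qed

text \<open>
  The coefficient of \<open>t\<^sup>2\<close> in the value at \<open>\<mu> + t \<phi> + t\<^sup>2 r \<psi>\<close>: the second-order term of the law enters
  through the first differential only.  The factor \<open>r\<close> allows for a change of sign.
\<close>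

lemma coeff_2_expansion:
  "coeff (free_eval (\<lambda>c. [:\<iota> c:]) u (\<lambda>i j l. [:\<mu> i j l, \<phi> i j l, r * \<psi> i j l:]) br (\<lambda>v b. [:\<rho> v b:]) f l) 2 =
    coeff (free_eval (\<lambda>c. [:\<iota> c:]) u (\<lambda>i j l. [:\<mu> i j l, \<phi> i j l:]) br (\<lambda>v b. [:\<rho> v b:]) f l) 2
    + r * D1 \<iota> u br \<rho> f \<mu> \<psi> l"
proof -
  let ?G = "two_param \<iota> u br \<rho> f \<mu> \<phi> \<psi> l"
  have "poly ?G (monom r 2) =
      free_eval (\<lambda>c. [:\<iota> c:]) u (\<lambda>i j l. [:\<mu> i j l, \<phi> i j l, r * \<psi> i j l:]) br (\<lambda>v b. [:\<rho> v b:]) f l"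
    by (simp add: two_param_subst monom_Suc monom_0 numeral_2_eq_2 mult.commute)
  with coeff_poly_monom_2[of ?G r] two_param_coeff_1[of \<iota> u br \<rho> f \<mu> \<phi> \<psi> l] show ?thesis
    by (simp add: two_param_coeff_0)
qed

text \<open>
  The substitution \<open>\<tau> = s + t\<close>, from \<open>k[\<tau>]\<close> to \<open>k[t][s]\<close>.
\<close>

definition polarize :: "'k::idom poly \<Rightarrow> 'k poly poly" where
  "polarize p = poly (map_poly (\<lambda>a. [:[:a:]:]) p) [:[:0, 1:], 1:]"

lemma unital_ring_hom_polarize: "unital_ring_hom polarize"
  unfolding polarize_def
  by (intro unital_ring_hom_comp[OF _ unital_ring_hom_poly] unital_ring_hom_map_poly)
    (simp add: unital_ring_hom_def one_pCons)

lemma polarize_pCons: "polarize (pCons a p) = [:[:a:]:] + [:[:0, 1:], 1:] * polarize p"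
  by (simp add: polarize_def map_poly_pCons)

lemma coeff_polarize_00: "coeff (coeff (polarize p) 0) 0 = coeff p 0"
  by (cases p) (simp add: polarize_pCons coeff_pCons)

lemma coeff_polarize_11: "coeff (coeff (polarize p) 1) 1 = 2 * coeff p 2"
proof -
  have c01: "coeff (coeff (polarize p) 0) 1 = coeff p 1" for p :: "'a poly"
    by (cases p) (simp add: polarize_pCons coeff_pCons coeff_polarize_00)
  have c10: "coeff (coeff (polarize p) 1) 0 = coeff p 1" for p :: "'a poly"
    by (cases p) (simp add: polarize_pCons coeff_pCons coeff_polarize_00)
  obtain a q where p: "p = pCons a q" by (cases p)
  show ?thesis using c01[of q] c10[of q] by (simp add: p polarize_pCons coeff_pCons numeral_2_eq_2)
qed

text \<open>
  The second differential is the coefficient of \<open>s t\<close> in the value at \<open>\<mu> + (s + t) \<phi>\<close>, which is the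
  image under polarization of the value at \<open>\<mu> + \<tau> \<phi>\<close>; and \<open>\<tau>\<^sup>2\<close> goes to \<open>s\<^sup>2 + 2 s t + t\<^sup>2\<close>.  So half of the
  second differential is the coefficient of \<open>\<tau>\<^sup>2\<close>.
\<close>

lemma D2_diagonal:
  "D2 \<iota> u br \<rho> f \<mu> \<phi> \<phi> l =
    2 * coeff (free_eval (\<lambda>c. [:\<iota> c:]) u (\<lambda>i j l. [:\<mu> i j l, \<phi> i j l:]) br (\<lambda>v b. [:\<rho> v b:]) f l) 2"
proof -
  have "D2 \<iota> u br \<rho> f \<mu> \<phi> \<phi> l = coeff (coeff (two_param \<iota> u br \<rho> f \<mu> \<phi> \<phi> l) 1) 1"
    unfolding D2_def poly_pderiv_0 D1_coeff two_param_def ..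
  also have "two_param \<iota> u br \<rho> f \<mu> \<phi> \<phi> l = polarize
      (free_eval (\<lambda>c. [:\<iota> c:]) u (\<lambda>i j l. [:\<mu> i j l, \<phi> i j l:]) br (\<lambda>v b. [:\<rho> v b:]) f l)"
    unfolding two_param_def
    by (subst free_eval_hom[OF unital_ring_hom_polarize])
      (simp add: polarize_pCons unital_ring_hom_simps[OF unital_ring_hom_polarize])
  finally show ?thesis by (simp only: coeff_polarize_11)
qed

section \<open>Coefficients of a deformed multiplication\<close>

definition law_coeff :: "nat \<Rightarrow> ('b, 'k::comm_ring_1 poly) law \<Rightarrow> ('b, 'k) law" where
  "law_coeff n C = (\<lambda>i j l. coeff (C i j l) n)"

lemma coeff_mult_const_right:
  "coeff (mult C X (\<lambda>b. [:y b:]) l) n = (\<Sum>a\<le>n. mult (law_coeff (n - a) C) (\<lambda>b. coeff (X b) a) y l)"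
proof -
  have t: "coeff (X i * [:y j:] * C i j l) n = (\<Sum>a\<le>n. coeff (X i) a * y j * coeff (C i j l) (n - a))" for i j
  proof -
    have "X i * [:y j:] * C i j l = smult (y j) (X i * C i j l)" by simp
    then show ?thesis by (simp add: coeff_mult sum_distrib_left mult_ac)
  qed
  have "coeff (mult C X (\<lambda>b. [:y b:]) l) n =
      (\<Sum>i\<in>UNIV. \<Sum>j\<in>UNIV. \<Sum>a\<le>n. coeff (X i) a * y j * coeff (C i j l) (n - a))"
    by (simp only: mult_def coeff_sum t)
  also have "\<dots> = (\<Sum>i\<in>UNIV. \<Sum>a\<le>n. \<Sum>j\<in>UNIV. coeff (X i) a * y j * coeff (C i j l) (n - a))"
    by (intro sum.cong refl sum.swap)
  also have "\<dots> = (\<Sum>a\<le>n. \<Sum>i\<in>UNIV. \<Sum>j\<in>UNIV. coeff (X i) a * y j * coeff (C i j l) (n - a))"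
    by (rule sum.swap)
  finally show ?thesis by (simp only: mult_def law_coeff_def)
qed

lemma mult_flip: "mult C x y = mult (\<lambda>i j. C j i) y x"
  unfolding mult_def by (rule ext, subst sum.swap) (simp only: mult_ac)

lemma coeff_mult_const_left:
  "coeff (mult C (\<lambda>b. [:x b:]) Y l) n = (\<Sum>a\<le>n. mult (law_coeff (n - a) C) x (\<lambda>b. coeff (Y b) a) l)"
  unfolding mult_flip[of C] coeff_mult_const_right mult_flip[of _ x] by (simp add: law_coeff_def)

lemma coeff_mult_const: "coeff (mult C (\<lambda>b. [:x b:]) (\<lambda>b. [:y b:]) l) n = mult (law_coeff n C) x y l"
proof -
  have "mult (law_coeff (n - a) C) (\<lambda>b. coeff [:x b:] a) y l = (if a = 0 then mult (law_coeff n C) x y l else 0)" for a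
    by (cases a) (simp_all add: mult_vec_0_left)
  then show ?thesis by (simp add: coeff_mult_const_right)
qed

text \<open>
  With constant arguments, the associativity law for \<open>C = C\<^sub>0 + t C\<^sub>1 + t\<^sup>2 C\<^sub>2 + \<dots>\<close> splits into one equation
  for each power of \<open>t\<close>.  For \<open>t\<^sup>1\<close> this will be the cocycle condition, and for \<open>t\<^sup>2\<close> the obstruction equation.
\<close>

lemma coeff_associator_left:
  "coeff (mult C (mult C (\<lambda>b. [:x b:]) (\<lambda>b. [:y b:])) (\<lambda>b. [:z b:]) l) n =
    (\<Sum>a\<le>n. mult (law_coeff (n - a) C) (mult (law_coeff a C) x y) z l)"
  by (subst coeff_mult_const_right) (simp only: coeff_mult_const)

lemma coeff_associator_right:
  "coeff (mult C (\<lambda>b. [:x b:]) (mult C (\<lambda>b. [:y b:]) (\<lambda>b. [:z b:])) l) n =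
    (\<Sum>a\<le>n. mult (law_coeff (n - a) C) x (mult (law_coeff a C) y z) l)"
  by (subst coeff_mult_const_left) (simp only: coeff_mult_const)

section \<open>Bilinear cochains and their structure constants\<close>

lemma linear_expand:
  fixes F :: "('b::finite \<Rightarrow> 'k::field) \<Rightarrow> 'b \<Rightarrow> 'k"
  assumes "Vector_Spaces.linear vscale vscale F"
  shows "F x = (\<lambda>l. \<Sum>b\<in>UNIV. x b * F (basis_vec b) l)"
proof -
  have add: "F (x + y) = F x + F y" and scale: "F (vscale a x) = vscale a (F x)" for a x y
    using assms by (auto simp: Vector_Spaces.linear_iff)
  have 0: "F 0 = 0" using scale[of 0 0] by (simp add: vscale_def zero_fun_def)
  have "F (\<lambda>l. \<Sum>b\<in>A. x b * basis_vec b l) = (\<lambda>l. \<Sum>b\<in>A. x b * F (basis_vec b) l)" for A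
  proof (induction A rule: infinite_finite_induct)
    case (insert b A)
    have eq: "(\<lambda>l. \<Sum>b\<in>insert b A. x b * basis_vec b l) = vscale (x b) (basis_vec b) + (\<lambda>l. \<Sum>b\<in>A. x b * basis_vec b l)"
      using insert.hyps by (simp add: vscale_def fun_eq_iff)
    show ?case
      unfolding eq add scale insert.IH using insert.hyps by (simp add: vscale_def fun_eq_iff)
  qed (use 0 in \<open>simp_all add: zero_fun_def\<close>)
  then show ?thesis using vec_basis_expansion[of x] by metis
qed

text \<open>
  By bilinearity, a 2-cochain amounts to its structure constants.
\<close>

lemma bilinear_cochain:
  assumes "\<phi> \<in> multilinear_maps 2"
  shows "\<phi> [x, y] = mult (cochain_law \<phi>) x y"
proof -
  have lin: "Vector_Spaces.linear vscale vscale (\<lambda>x. \<phi> (xs[i := x]))" if "length xs = 2" "i < 2" for xs i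
    using assms that by (auto simp: multilinear_maps_def)
  have 1: "\<phi> [x, y] = (\<lambda>l. \<Sum>i\<in>UNIV. x i * \<phi> [basis_vec i, y] l)" for x y
    by (rule linear_expand[where F = "\<lambda>x. \<phi> [x, y]"]) (use lin[of "[x, y]" 0] in simp)
  have 2: "\<phi> [x, y] = (\<lambda>l. \<Sum>j\<in>UNIV. y j * \<phi> [x, basis_vec j] l)" for x y
    by (rule linear_expand[where F = "\<lambda>y. \<phi> [x, y]"]) (use lin[of "[x, y]" 1] in simp)
  show ?thesis
    unfolding 1[of x y] 2[of "basis_vec _" y] by (simp add: mult_def cochain_law_def sum_distrib_left mult.assoc)
qed

definition law_cochain :: "('b::finite, 'k::field) law \<Rightarrow> ('b, 'k) cochain" where
  "law_cochain c xs = (case xs of [x, y] \<Rightarrow> mult c x y | _ \<Rightarrow> 0)"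

lemma cochain_law_law_cochain: "cochain_law (law_cochain c) = c"
  by (simp add: cochain_law_def law_cochain_def mult_basis fun_eq_iff)

lemma vector_space_vscale: "vector_space vscale"
  by standard (simp_all add: vscale_def fun_eq_iff algebra_simps)

lemma length_2_conv: "length xs = 2 \<longleftrightarrow> (\<exists>x y. xs = [x, y])"
  by (auto simp: numeral_2_eq_2 length_Suc_conv)

lemma law_cochain_in_cochains:
  assumes graded: "\<And>i j l. deg l \<noteq> deg i + deg j \<Longrightarrow> c i j l = 0"
    and unit: "\<And>x. mult c (\<lambda>b. \<iota> (u b)) x = (\<lambda>l. 0)" "\<And>x. mult c x (\<lambda>b. \<iota> (u b)) = (\<lambda>l. 0)"
  shows "law_cochain c \<in> cochains \<iota> deg u 2"
  unfolding cochains_def multilinear_maps_def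
proof (intro CollectI conjI allI impI)
  fix xs :: "('a \<Rightarrow> 'c) list" and i :: nat assume "length xs = 2" "i < 2"
  then obtain x y where xs: "xs = [x, y]" and i: "i = 0 \<or> i = 1"
    by (auto simp: length_2_conv less_2_cases_iff)
  from i show "Vector_Spaces.linear vscale vscale (\<lambda>x. law_cochain c (xs[i := x]))"
    unfolding Vector_Spaces.linear_iff xs using vector_space_vscale
    by (auto simp: law_cochain_def vscale_def plus_fun_def mult_add_left mult_add_right
        mult_scale_left mult_scale_right)
next
  fix xs :: "('a \<Rightarrow> 'c) list" assume "length xs \<noteq> 2"
  then show "law_cochain c xs = 0" by (auto simp: law_cochain_def split: list.split)
next
  fix xs :: "('a \<Rightarrow> 'c) list" and gs assume "length xs = 2" "list_all2 (homogeneous deg) gs xs"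
  then obtain x y g h where xs: "xs = [x, y]" and gs: "gs = [g, h]"
    and "homogeneous deg g x" "homogeneous deg h y"
    by (auto simp: length_2_conv list_all2_Cons2)
  then have 0: "x i * y j * c i j l = 0" if "deg l \<noteq> g + h" for i j l
    using graded[of l i j] that unfolding homogeneous_def by fastforce
  have "mult c x y l = 0" if "deg l \<noteq> g + h" for l
    unfolding mult_def by (intro sum.neutral ballI 0 that)
  then show "homogeneous deg (sum_list gs) (law_cochain c xs)"
    unfolding homogeneous_def xs gs law_cochain_def by auto
next
  fix xs :: "('a \<Rightarrow> 'c) list" assume "length xs = 2" "(\<lambda>b. \<iota> (u b)) \<in> set xs"
  then show "law_cochain c xs = 0" by (auto simp: length_2_conv law_cochain_def unit zero_fun_def)
qed

section \<open>Cocycles, deformations and the obstruction class\<close>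

lemma atMost_1: "{..1::nat} = {0, 1}" and atMost_2: "{..2::nat} = {0, 1, 2}"
  by auto

lemma monom_2_dvd_iff: "monom 1 2 dvd (p :: 'k::field poly) \<longleftrightarrow> coeff p 0 = 0 \<and> coeff p 1 = 0"
  by (auto simp: monom_1_dvd_iff' numeral_2_eq_2 All_less_Suc)

lemma coeff_const_2: "coeff [:a:] 2 = 0"
  by (simp add: numeral_2_eq_2)

lemma basis_vec_const_poly: "basis_vec i = (\<lambda>b. [:basis_vec i b:])"
  by (simp add: basis_vec_def fun_eq_iff one_pCons)

lemma cochain_unit:
  assumes "\<phi> \<in> cochains \<iota> deg u 2"
  shows "mult (cochain_law \<phi>) (\<lambda>b. \<iota> (u b)) x = (\<lambda>l. 0)" "mult (cochain_law \<phi>) x (\<lambda>b. \<iota> (u b)) = (\<lambda>l. 0)"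
proof -
  have "\<phi> \<in> multilinear_maps 2" using assms by (simp add: cochains_def)
  note \<phi> = bilinear_cochain[OF this, symmetric]
  have "\<phi> xs = 0" if "length xs = 2" "(\<lambda>b. \<iota> (u b)) \<in> set xs" for xs
    using assms that unfolding cochains_def by blast
  then show "mult (cochain_law \<phi>) (\<lambda>b. \<iota> (u b)) x = (\<lambda>l. 0)" "mult (cochain_law \<phi>) x (\<lambda>b. \<iota> (u b)) = (\<lambda>l. 0)"
    unfolding \<phi> zero_fun_def[symmetric] by simp_all
qed

lemma cochain_law_graded:
  fixes \<phi> :: "('b::finite, 'k::field) cochain"
  assumes "\<phi> \<in> cochains \<iota> deg u 2" "deg l \<noteq> deg i + deg j"
  shows "cochain_law \<phi> i j l = 0"
proof -
  have hom: "homogeneous deg (sum_list gs) (\<phi> xs)"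
    if "length xs = 2" "list_all2 (homogeneous deg) gs xs" for xs gs
    using assms(1) that unfolding cochains_def by blast
  have "homogeneous deg (sum_list [deg i, deg j]) (\<phi> [basis_vec i, basis_vec j])"
    by (rule hom) (simp_all add: homogeneous_def basis_vec_def)
  with assms(2) show ?thesis by (auto simp: homogeneous_def cochain_law_def)
qed

text \<open>
  The conditions on \<open>\<phi>\<close> say that the coefficients of \<open>t\<close> in the defining equations for \<open>\<mu> + t \<phi>\<close>
  vanish: in the associativity law this coefficient is the Hochschild differential of \<open>\<phi>\<close>, in the unit
  laws it is \<open>\<phi>\<close> with an argument \<open>\<one>\<close>, and in a generator it is the first differential.  The constant
  terms vanish because \<open>\<mu>\<close> is itself an algebra satisfying \<open>I\<close>.
\<close>

lemma cocycle_deformation: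
  fixes \<iota> :: "'f::field \<Rightarrow> 'k::field" and \<mu> :: "('b::finite, 'k) law"
    and deg :: "'b \<Rightarrow> 'g::group_add" and fs :: "('f, 'g) mgen list"
  assumes \<iota>: "unital_ring_hom \<iota>" and u: "homogeneous deg 0 u"
    and fs: "\<And>f. f \<in> set fs \<Longrightarrow> multilinear_generator f"
    and I: "I = T_ideal_generated (gen_poly ` set fs)"
    and \<mu>: "graded_I_law \<iota> 0 deg u I \<mu>" and \<phi>: "\<phi> \<in> Z2 \<iota> deg u I \<mu>"
  shows "I_deformation \<iota> deg u I \<mu> 1 (\<lambda>i j l. [:\<mu> i j l, cochain_law \<phi> i j l:])"
proof -
  note h = unital_ring_hom_const_poly_comp[OF \<iota>]
  define M where "M = (\<lambda>i j l. [:\<mu> i j l, cochain_law \<phi> i j l:])"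
  have M0: "law_coeff 0 M = \<mu>" and M1: "law_coeff 1 M = cochain_law \<phi>"
    by (simp_all add: law_coeff_def M_def)
  interpret \<mu>: graded_law_mod \<iota> 0 deg u \<mu>
    using \<mu> unfolding graded_I_law_iff[OF \<iota> u] by blast
  have \<mu>_sat: "I \<subseteq> \<mu>.satisfied" using \<mu> unfolding graded_I_law_iff[OF \<iota> u] by blast
  have \<phi>c: "\<phi> \<in> cochains \<iota> deg u 2" and d0: "d_Hoch \<mu> \<phi> = 0"
    and D0: "\<And>f \<rho>. f \<in> I \<Longrightarrow> (\<forall>v. homogeneous deg (snd v) (\<rho> v)) \<Longrightarrow> D1 \<iota> u std_br \<rho> f \<mu> (cochain_law \<phi>) = 0"
    using \<phi> by (auto simp: Z2_def)
  have "\<phi> \<in> multilinear_maps 2" using \<phi>c by (simp add: cochains_def)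
  note \<phi>m = bilinear_cochain[OF this]
  have cocycle: "mult (cochain_law \<phi>) (mult \<mu> x y) z l + mult \<mu> (mult (cochain_law \<phi>) x y) z l =
      mult (cochain_law \<phi>) x (mult \<mu> y z) l + mult \<mu> x (mult (cochain_law \<phi>) y z) l" for x y z l
    using fun_cong[OF fun_cong[OF d0, of "[x, y, z]"], of l]
    by (simp add: d_Hoch_def \<phi>m algebra_simps)
  have assoc0: "mult \<mu> (mult \<mu> x y) z = mult \<mu> x (mult \<mu> y z)" for x y z
    using \<mu>.assoc[of x y z] by (simp add: vcong_def fun_eq_iff)
  interpret M: graded_law_mod "\<lambda>c. [:\<iota> c:]" "monom 1 2" deg u M
  proof (rule graded_law_mod_basisI[OF h u])
    fix i j l assume "deg l \<noteq> deg i + deg j"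
    then show "monom 1 2 dvd M i j l"
      using \<mu>.graded cochain_law_graded[OF \<phi>c] by (simp add: monom_2_dvd_iff M_def)
  next
    fix i j k
    show "vcong (monom 1 2) (mult M (mult M (basis_vec i) (basis_vec j)) (basis_vec k))
        (mult M (basis_vec i) (mult M (basis_vec j) (basis_vec k)))"
      unfolding vcong_def monom_2_dvd_iff coeff_diff basis_vec_const_poly
        coeff_associator_left coeff_associator_right atMost_1
      by (simp add: M0 M1[simplified] assoc0 cocycle)
  next
    fix i
    have "mult \<mu> (\<lambda>b. \<iota> (u b)) x = x" "mult \<mu> x (\<lambda>b. \<iota> (u b)) = x" for x
      using \<mu>.unit_left[of x] \<mu>.unit_right[of x] by (simp_all add: vcong_def fun_eq_iff)
    note unit = this cochain_unit[OF \<phi>c]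
    show "vcong (monom 1 2) (mult M (\<lambda>b. [:\<iota> (u b):]) (basis_vec i)) (basis_vec i)"
      unfolding vcong_def monom_2_dvd_iff coeff_diff basis_vec_const_poly coeff_mult_const
      by (simp add: M0 M1[simplified] unit)
    show "vcong (monom 1 2) (mult M (basis_vec i) (\<lambda>b. [:\<iota> (u b):])) (basis_vec i)"
      unfolding vcong_def monom_2_dvd_iff coeff_diff basis_vec_const_poly coeff_mult_const
      by (simp add: M0 M1[simplified] unit)
  qed
  have "gen_poly f \<in> M.satisfied" if f: "f \<in> set fs" for f
  proof (rule M.multilinear_satisfied[OF fs[OF f]])
    fix bs l
    define \<rho> :: "'g gvar \<Rightarrow> 'b \<Rightarrow> 'k" where "\<rho> = assign deg (gen_vars f) (map basis_vec bs)"
    have \<rho>: "homogeneous deg (snd v) (\<rho> v)" for v unfolding \<rho>_def by (rule homogeneous_assign)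
    have \<rho>_const: "assign deg (gen_vars f) (map basis_vec bs) = (\<lambda>v b. [:\<rho> v b:])"
      unfolding \<rho>_def hom_assign[OF unital_ring_hom_const_poly]
      by (simp add: o_def basis_vec_const_poly[symmetric])
    have fI: "gen_poly f \<in> I" using f by (auto simp: I T_ideal_generated_def)
    let ?p = "free_eval (\<lambda>c. [:\<iota> c:]) u M std_br (\<lambda>v b. [:\<rho> v b:]) (gen_poly f) l"
    have "coeff ?p 0 = free_eval \<iota> u \<mu> std_br \<rho> (gen_poly f) l"
      unfolding poly_0_coeff_0[symmetric] by (subst free_eval_hom[OF unital_ring_hom_poly]) (simp add: M_def)
    also have "\<dots> = 0" using \<mu>.satisfiedD[OF subsetD[OF \<mu>_sat fI] \<rho>] by simp
    finally have "coeff ?p 0 = 0" .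
    moreover have "coeff ?p 1 = 0"
      using D0[OF fI, of \<rho>] \<rho> unfolding M_def D1_coeff[symmetric] by simp
    ultimately have p: "monom 1 2 dvd ?p" by (simp add: monom_2_dvd_iff)
    have "vcong (monom 1 2) (free_eval (\<lambda>c. [:\<iota> c:]) u M (gen_br f) (\<lambda>v b. [:\<rho> v b:]) (gen_poly f))
        (free_eval (\<lambda>c. [:\<iota> c:]) u M std_br (\<lambda>v b. [:\<rho> v b:]) (gen_poly f))"
      using fs[OF f] by (intro M.free_eval_bracketing) (auto simp: multilinear_generator_def)
    note eq = vcong_dvd_iff[OF this]
    from p show "monom 1 2 dvd free_eval (\<lambda>c. [:\<iota> c:]) u M (gen_br f)
        (assign deg (gen_vars f) (map basis_vec bs)) (gen_poly f) l"
      unfolding \<rho>_const eq .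
  qed
  then have "graded_I_law (\<lambda>c. [:\<iota> c:]) (monom 1 2) deg u I M"
    unfolding graded_I_law_iff[OF h u] I M.T_ideal_generated_satisfied
    using M.graded_law_mod_axioms by blast
  then show ?thesis
    unfolding I_deformation_def M_def one_add_one law_cong_def by (simp add: monom_1_dvd_iff')
qed

text \<open>
  Let \<open>\<mu> + t \<phi> + t\<^sup>2 \<phi>'\<close> satisfy all conditions modulo \<open>t\<^sup>3\<close>.  The coefficients of \<open>t\<^sup>2\<close> say that \<open>\<L>\<close> at
  \<open>\<phi>'\<close> plus the quadratic expression in \<open>\<phi>\<close> is zero; hence \<open>\<psi> = - \<phi>'\<close> is a preimage of the obstruction.
  Gradedness and the unit laws in degree two make \<open>\<psi>\<close> a normalized cochain.
\<close>

lemma second_order_deformation_solves: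
  fixes \<iota> :: "'f::field_char_0 \<Rightarrow> 'k::field" and \<mu> :: "('b::finite, 'k) law"
    and deg :: "'b \<Rightarrow> 'g::group_add" and fs :: "('f, 'g) mgen list"
  assumes \<iota>: "unital_ring_hom \<iota>" and u: "homogeneous deg 0 u"
    and fs: "\<And>f. f \<in> set fs \<Longrightarrow> multilinear_generator f"
    and I: "I = T_ideal_generated (gen_poly ` set fs)"
    and \<phi>: "\<phi> \<in> cochains \<iota> deg u 2"
    and M: "I_deformation \<iota> deg u I \<mu> 2 M"
      "law_cong 2 M (\<lambda>i j l. [:\<mu> i j l, cochain_law \<phi> i j l:])"
  shows "\<exists>\<psi>\<in>cochains \<iota> deg u 2. L_map \<iota> deg u fs \<mu> \<psi> =
    (Q_ass \<phi>, \<lambda>j. if j < length fs then gen_Q \<iota> deg u (fs ! j) \<mu> \<phi> else 0)"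
proof -
  note h = unital_ring_hom_const_poly_comp[OF \<iota>]
  have "graded_I_law (\<lambda>c. [:\<iota> c:]) (monom 1 3) deg u I M"
    using M(1) by (simp add: I_deformation_def)
  then have law: "graded_law_mod (\<lambda>c. [:\<iota> c:]) (monom 1 3) deg u M"
    and sat: "I \<subseteq> graded_law_mod.satisfied (\<lambda>c. [:\<iota> c:]) (monom 1 3) deg u M"
    unfolding graded_I_law_iff[OF h u] by blast+
  interpret M: graded_law_mod "\<lambda>c. [:\<iota> c:]" "monom 1 3" deg u M by (rule law)
  have M01: "coeff (M i j l) 0 = \<mu> i j l" "coeff (M i j l) 1 = cochain_law \<phi> i j l" for i j l
  proof -
    have "monom 1 2 dvd M i j l - [:\<mu> i j l, cochain_law \<phi> i j l:]"
      using M(2) by (simp add: law_cong_def)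
    then show "coeff (M i j l) 0 = \<mu> i j l" "coeff (M i j l) 1 = cochain_law \<phi> i j l"
      by (simp_all add: monom_2_dvd_iff)
  qed
  have coeff2: "coeff p 2 = 0" if "monom 1 3 dvd p" for p :: "'k poly"
    using that by (simp add: monom_1_dvd_iff')
  \<comment> \<open>the sign makes \<open>\<L> \<psi>\<close> equal to the quadratic expression rather than to its negative\<close>
  define c where "c i j l = - coeff (M i j l) 2" for i j l
  have L: "law_coeff 0 M = \<mu>" "law_coeff 1 M = cochain_law \<phi>" "law_coeff 2 M = (\<lambda>i j l. - c i j l)"
    using M01 by (simp_all add: law_coeff_def c_def)
  have neg: "mult (\<lambda>i j l. - c i j l) x y = (\<lambda>l. - mult c x y l)" for x y
    by (simp add: mult_def sum_negf)
  have graded: "c i j l = 0" if "deg l \<noteq> deg i + deg j" for i j l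
    using coeff2[OF M.graded[OF that]] by (simp add: c_def)
  have unit_left: "mult c (\<lambda>b. \<iota> (u b)) x l = 0" for x l
    using coeff2[OF M.unit_left[of "\<lambda>b. [:x b:]", unfolded vcong_def, rule_format, of l]]
    by (simp add: coeff_mult_const L neg coeff_const_2)
  have unit_right: "mult c x (\<lambda>b. \<iota> (u b)) l = 0" for x l
    using coeff2[OF M.unit_right[of "\<lambda>b. [:x b:]", unfolded vcong_def, rule_format, of l]]
    by (simp add: coeff_mult_const L neg coeff_const_2)
  define \<psi> where "\<psi> = law_cochain c"
  have \<psi>_law: "cochain_law \<psi> = c" unfolding \<psi>_def by (rule cochain_law_law_cochain)
  have \<psi>: "\<psi> \<in> cochains \<iota> deg u 2"
    unfolding \<psi>_def by (rule law_cochain_in_cochains) (simp_all add: graded unit_left unit_right fun_eq_iff)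
  have "\<phi> \<in> multilinear_maps 2" using \<phi> by (simp add: cochains_def)
  note \<phi>m = bilinear_cochain[OF this]
  have assoc: "- mult c (mult \<mu> x y) z l + mult (cochain_law \<phi>) (mult (cochain_law \<phi>) x y) z l
        - mult \<mu> (mult c x y) z l =
      - mult c x (mult \<mu> y z) l + mult (cochain_law \<phi>) x (mult (cochain_law \<phi>) y z) l
        - mult \<mu> x (mult c y z) l" for x y z l
  proof -
    have neg\<mu>: "mult \<mu> (\<lambda>l. - x l) y l = - mult \<mu> x y l" "mult \<mu> x (\<lambda>l. - y l) l = - mult \<mu> x y l" for x y
      by (simp_all add: mult_def sum_negf)
    have "(\<Sum>a\<le>2. mult (law_coeff (2 - a) M) (mult (law_coeff a M) x y) z l) =
        (\<Sum>a\<le>2. mult (law_coeff (2 - a) M) x (mult (law_coeff a M) y z) l)"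
      using coeff2[OF M.assoc[of "\<lambda>b. [:x b:]" "\<lambda>b. [:y b:]" "\<lambda>b. [:z b:]", unfolded vcong_def, rule_format, of l]]
      unfolding coeff_diff coeff_associator_left coeff_associator_right by (simp only: right_minus_eq)
    moreover have "(2::nat) - 1 = 1" "(2::nat) - 2 = 0" "(2::nat) - 0 = 2" by simp_all
    ultimately show ?thesis unfolding atMost_2 by (simp add: L L(2)[simplified] neg neg\<mu> algebra_simps)
  qed
  have dQ: "d_Hoch \<mu> \<psi> = Q_ass \<phi>"
  proof (intro ext)
    fix xs l
    show "d_Hoch \<mu> \<psi> xs l = Q_ass \<phi> xs l"
    proof (cases "\<exists>x y z. xs = [x, y, z]")
      case True
      then obtain x y z where "xs = [x, y, z]" by blast
      with assoc[of x y z l] show ?thesis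
        by (simp add: d_Hoch_def Q_ass_def \<phi>m \<psi>_def law_cochain_def algebra_simps)
    next
      case False
      then show ?thesis by (auto simp: d_Hoch_def Q_ass_def split: list.split)
    qed
  qed
  have two: "(2::'k) \<noteq> 0"
  proof -
    have "\<iota> (1 / 2) * \<iota> 2 = 1" and "\<iota> 2 = 2"
      using unital_ring_hom_simps(4)[OF \<iota>, of "1/2" 2] unital_ring_hom_simps(3)[OF \<iota>, of 1 1]
      by (simp_all add: unital_ring_hom_simps(2)[OF \<iota>])
    then show ?thesis by auto
  qed
  have DQ: "gen_D \<iota> deg u f \<mu> \<psi> = gen_Q \<iota> deg u f \<mu> \<phi>" if f: "f \<in> set fs" for f
  proof (intro ext)
    fix xs :: "('b \<Rightarrow> 'k) list" and l
    define \<rho> where "\<rho> = assign deg (gen_vars f) xs"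
    have \<rho>: "homogeneous deg (snd v) (\<lambda>b. [:\<rho> v b:])" for v
      using homogeneous_assign[of deg v "gen_vars f" xs] by (simp add: homogeneous_def \<rho>_def)
    let ?E = "\<lambda>M. free_eval (\<lambda>c. [:\<iota> c:]) u M (gen_br f) (\<lambda>v b. [:\<rho> v b:]) (gen_poly f) l"
    have fI: "gen_poly f \<in> I" using f by (auto simp: I T_ideal_generated_def)
    have "monom 1 3 dvd M i j l - [:\<mu> i j l, cochain_law \<phi> i j l, -1 * c i j l:]" for i j l
      using M01[of i j l]
      by (auto simp: monom_1_dvd_iff' c_def numeral_3_eq_3 less_Suc_eq coeff_pCons numeral_2_eq_2 split: nat.split)
    then have "vcong (monom 1 3) (free_eval (\<lambda>c. [:\<iota> c:]) u M (gen_br f) (\<lambda>v b. [:\<rho> v b:]) (gen_poly f))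
        (free_eval (\<lambda>c. [:\<iota> c:]) u (\<lambda>i j l. [:\<mu> i j l, cochain_law \<phi> i j l, -1 * c i j l:])
          (gen_br f) (\<lambda>v b. [:\<rho> v b:]) (gen_poly f))"
      by (intro free_eval_cong_law vcong_refl)
    note eq = vcong_dvd_iff[OF this]
    from M.satisfied_generator[OF fs[OF f] subsetD[OF sat fI] \<rho>, of l]
    have "monom 1 3 dvd ?E (\<lambda>i j l. [:\<mu> i j l, cochain_law \<phi> i j l, -1 * c i j l:])"
      unfolding eq .
    from coeff2[OF this] have "coeff (?E (\<lambda>i j l. [:\<mu> i j l, cochain_law \<phi> i j l:])) 2 =
        D1 \<iota> u (gen_br f) \<rho> (gen_poly f) \<mu> c l"
      unfolding coeff_2_expansion by simp
    with two show "gen_D \<iota> deg u f \<mu> \<psi> xs l = gen_Q \<iota> deg u f \<mu> \<phi> xs l"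
      by (simp add: gen_D_def gen_Q_def \<psi>_law vscale_def D2_diagonal \<rho>_def)
  qed
  have "L_map \<iota> deg u fs \<mu> \<psi> =
      (Q_ass \<phi>, \<lambda>j. if j < length fs then gen_Q \<iota> deg u (fs ! j) \<mu> \<phi> else 0)"
    unfolding L_map_def dQ by (auto simp: DQ fun_eq_iff)
  with \<psi> show ?thesis by blast
qed

text \<open>
  Linearity of \<open>\<L>\<close>, in the form that covers sums (\<open>r = 1\<close>) and differences (\<open>r = -1\<close>).
\<close>

lemma L_map_affine:
  "L_map \<iota> deg u fs \<mu> (\<lambda>xs b. \<chi> xs b + r * \<psi> xs b) =
    ((\<lambda>xs b. fst (L_map \<iota> deg u fs \<mu> \<chi>) xs b + r * fst (L_map \<iota> deg u fs \<mu> \<psi>) xs b),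
     (\<lambda>j xs b. snd (L_map \<iota> deg u fs \<mu> \<chi>) j xs b + r * snd (L_map \<iota> deg u fs \<mu> \<psi>) j xs b))"
proof -
  have "d_Hoch \<mu> (\<lambda>xs b. \<chi> xs b + r * \<psi> xs b) xs l = d_Hoch \<mu> \<chi> xs l + r * d_Hoch \<mu> \<psi> xs l" for xs l
    by (auto simp: d_Hoch_def mult_add_left mult_add_right mult_scale_left mult_scale_right algebra_simps
        split: list.split)
  moreover have "gen_D \<iota> deg u f \<mu> (\<lambda>xs b. \<chi> xs b + r * \<psi> xs b) xs l =
      gen_D \<iota> deg u f \<mu> \<chi> xs l + r * gen_D \<iota> deg u f \<mu> \<psi> xs l" for f xs l
    using D1_affine[of \<iota> u "gen_br f" "assign deg (gen_vars f) xs" "gen_poly f" \<mu> "cochain_law \<chi>" r "cochain_law \<psi>" l]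
    by (simp add: gen_D_def cochain_law_def[abs_def])
  ultimately show ?thesis by (auto simp: L_map_def fun_eq_iff)
qed

lemma cochains_affine:
  fixes \<iota> :: "'f::field \<Rightarrow> 'd::field" and deg :: "'b \<Rightarrow> 'g::group_add"
  assumes "\<chi> \<in> cochains \<iota> deg u n" "\<psi> \<in> cochains \<iota> deg u n"
  shows "(\<lambda>xs b. \<chi> xs b + r * \<psi> xs b) \<in> cochains \<iota> deg u n"
  unfolding cochains_def multilinear_maps_def
proof (intro CollectI conjI allI impI)
  fix xs :: "('b \<Rightarrow> 'd) list" and i assume "length xs = n" "i < n"
  then have "Vector_Spaces.linear vscale vscale (\<lambda>x. \<chi> (xs[i := x]))"
    "Vector_Spaces.linear vscale vscale (\<lambda>x. \<psi> (xs[i := x]))"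
    using assms unfolding cochains_def multilinear_maps_def by blast+
  then show "Vector_Spaces.linear vscale vscale (\<lambda>x b. \<chi> (xs[i := x]) b + r * \<psi> (xs[i := x]) b)"
    unfolding Vector_Spaces.linear_iff by (simp add: fun_eq_iff vscale_def algebra_simps)
next
  fix xs :: "('b \<Rightarrow> 'd) list" assume "length xs \<noteq> n"
  with assms show "(\<lambda>b. \<chi> xs b + r * \<psi> xs b) = 0"
    by (auto simp: cochains_def multilinear_maps_def fun_eq_iff)
next
  fix xs :: "('b \<Rightarrow> 'd) list" and gs assume "length xs = n" "list_all2 (homogeneous deg) gs xs"
  with assms have "homogeneous deg (sum_list gs) (\<chi> xs)" "homogeneous deg (sum_list gs) (\<psi> xs)"
    unfolding cochains_def by blast+
  then show "homogeneous deg (sum_list gs) (\<lambda>b. \<chi> xs b + r * \<psi> xs b)"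
    unfolding homogeneous_def by (metis add.right_neutral mult_zero_right)
next
  fix xs :: "('b \<Rightarrow> 'd) list" assume "length xs = n" "(\<lambda>b. \<iota> (u b)) \<in> set xs"
  with assms have "\<chi> xs = 0" "\<psi> xs = 0" unfolding cochains_def by blast+
  then show "(\<lambda>b. \<chi> xs b + r * \<psi> xs b) = 0" by (simp add: fun_eq_iff)
qed

lemma coker_class_image:
  assumes "\<psi> \<in> cochains \<iota> deg u 2"
  shows "coker_class \<iota> deg u fs \<mu> (L_map \<iota> deg u fs \<mu> \<psi>) = coker_class \<iota> deg u fs \<mu> 0"
proof -
  let ?L = "L_map \<iota> deg u fs \<mu>" and ?C = "cochains \<iota> deg u 2"
  have "\<omega> - ?L \<psi> \<in> ?L ` ?C \<longleftrightarrow> \<omega> - 0 \<in> ?L ` ?C" for \<omega>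
  proof
    assume "\<omega> - ?L \<psi> \<in> ?L ` ?C"
    then obtain \<chi> where \<chi>: "\<chi> \<in> ?C" "\<omega> - ?L \<psi> = ?L \<chi>" by blast
    from \<chi>(2) have "\<omega> = ?L \<chi> + ?L \<psi>" by (metis diff_add_cancel)
    also have "\<dots> = ?L (\<lambda>xs b. \<chi> xs b + 1 * \<psi> xs b)"
      unfolding L_map_affine by (simp add: prod_eq_iff fun_eq_iff)
    finally show "\<omega> - 0 \<in> ?L ` ?C" using cochains_affine[OF \<chi>(1) assms, of 1] by simp
  next
    assume "\<omega> - 0 \<in> ?L ` ?C"
    then obtain \<chi> where \<chi>: "\<chi> \<in> ?C" "\<omega> = ?L \<chi>" by auto
    then have "\<omega> - ?L \<psi> = ?L (\<lambda>xs b. \<chi> xs b + (-1) * \<psi> xs b)"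
      unfolding L_map_affine by (simp add: prod_eq_iff fun_eq_iff)
    then show "\<omega> - ?L \<psi> \<in> ?L ` ?C" using cochains_affine[OF \<chi>(1) assms, of "-1"] by blast
  qed
  then show ?thesis unfolding coker_class_def by blast
qed

theorem corollary55:
  fixes \<iota> :: "'f::field_char_0 \<Rightarrow> 'k::field"
    and deg :: "'b::finite \<Rightarrow> 'g::{group_add,finite}"
    and u :: "'b \<Rightarrow> 'f"
    and fs :: "('f, 'g) mgen list"
    and I :: "('f, 'g) free_alg set"
    and \<mu> :: "('b, 'k) law"
  assumes "unital_ring_hom \<iota>"
    and "u \<noteq> 0" and "homogeneous deg 0 u"
    and "\<forall>f\<in>set fs. multilinear_generator f"
    and "I = T_ideal_generated (gen_poly ` set fs)"
    and "alg_point \<iota> deg u fs \<mu>"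
    and "smooth_at \<iota> (alg_ideal deg u fs) (law_point \<mu>)"
  shows "(\<forall>M. I_deformation \<iota> deg u I \<mu> 1 M \<longrightarrow>
            (\<forall>N\<ge>2. \<exists>M'. I_deformation \<iota> deg u I \<mu> N M' \<and> law_cong 2 M' M)) \<and>
         (\<forall>\<phi>\<in>Z2 \<iota> deg u I \<mu>. ob2 \<iota> deg u fs \<mu> \<phi> = coker_class \<iota> deg u fs \<mu> 0)"
proof -
  note \<iota> = assms(1) and u = assms(3) and I = assms(5)
  have fs: "multilinear_generator f" if "f \<in> set fs" for f using assms(4) that by blast
  have lift: "\<exists>M'. I_deformation \<iota> deg u I \<mu> N M' \<and> law_cong 2 M' M"
    if "I_deformation \<iota> deg u I \<mu> 1 M" "2 \<le> N" for M N
    by (rule first_order_deformation_lifts[OF \<iota> u fs I assms(7) that(1)]) (use that(2) in simp_all)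
  \<comment> \<open>divisibility by \<open>0\<close> is vanishing: a \<open>k\<close>-point is the case \<open>m = 0\<close>\<close>
  have "\<forall>p\<in>alg_equations deg u fs. 0 dvd peval \<iota> (law_point \<mu>) p"
    using assms(6) by (auto simp: alg_point_def alg_ideal_def in_ideal)
  then have \<mu>: "graded_I_law \<iota> 0 deg u I \<mu>"
    using alg_equations_vanish_iff[OF \<iota> u, of fs 0 \<mu>] fs I by blast
  have "ob2 \<iota> deg u fs \<mu> \<phi> = coker_class \<iota> deg u fs \<mu> 0" if \<phi>: "\<phi> \<in> Z2 \<iota> deg u I \<mu>" for \<phi>
  proof -
    have "I_deformation \<iota> deg u I \<mu> 1 (\<lambda>i j l. [:\<mu> i j l, cochain_law \<phi> i j l:])"
      by (rule cocycle_deformation[OF \<iota> u fs I \<mu> \<phi>])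
    then obtain M where "I_deformation \<iota> deg u I \<mu> 2 M"
      "law_cong 2 M (\<lambda>i j l. [:\<mu> i j l, cochain_law \<phi> i j l:])"
      using lift by blast
    moreover have "\<phi> \<in> cochains \<iota> deg u 2" using \<phi> by (simp add: Z2_def)
    ultimately have "\<exists>\<psi>\<in>cochains \<iota> deg u 2. L_map \<iota> deg u fs \<mu> \<psi> =
        (Q_ass \<phi>, \<lambda>j. if j < length fs then gen_Q \<iota> deg u (fs ! j) \<mu> \<phi> else 0)"
      by (intro second_order_deformation_solves[OF \<iota> u fs I])
    then obtain \<psi> where \<psi>: "\<psi> \<in> cochains \<iota> deg u 2" "L_map \<iota> deg u fs \<mu> \<psi> =
        (Q_ass \<phi>, \<lambda>j. if j < length fs then gen_Q \<iota> deg u (fs ! j) \<mu> \<phi> else 0)"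
      by blast
    show ?thesis
      unfolding ob2_def \<psi>(2)[symmetric] by (rule coker_class_image[OF \<psi>(1)])
  qed
  with lift show ?thesis by blast
qed

end
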